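(* For any real $\beta>1$, there is a family of continuous functions $\{f_\xi:[0,1]\to\mathbb{R}^+ : \xi\in\{0,1\}^\omega\}$ such that, for each $\xi\in\{0,1\}^\omega$, $\mathbf{E}_{f_\xi}$ is an equivalence relation with $$\mathbb{R}^\omega/\ell_1\le_B \mathbf{E}_{f_\xi}\le_B \mathbb{R}^\omega/\ell_\beta,$$ and, for any distinct $\xi,\zeta\in\{0,1\}^\omega$, the equivalence relations $\mathbf{E}_{f_\xi}$ and $\mathbf{E}_{f_\zeta}$ are Borel incomparable.
   Context: $\omega=\{0,1,2,\dots\}$ and $\mathbb{R}^+=[0,\infty)$ is the set of nonnegative real numbers. For a function $f:[0,1]\to\mathbb{R}^+$, $\mathbf{E}_f$ is the binary relation on $[0,1]^\omega$ defined by: $(x_n)_{n<\omega}\,\mathbf{E}_f\,(y_n)_{n<\omega}$ if and only if $\sum_{n<\omega} f(|y_n-x_n|)<\infty$. For $p\ge 1$, $\mathbb{R}^\omega/\ell_p$ denotes the equivalence relation on $\mathbb{R}^\omega$ in which $(x_n)$ and $(y_n)$ are equivalent if and only if $(x_n-y_n)_{n<\omega}\in\ell_p$, i.e. $\sum_{n<\omega}|x_n-y_n|^p<\infty$. The spaces $[0,1]^\omega$ and $\mathbb{R}^\omega$ carry the product topology and are Polish spaces. If $X,Y$ are Polish spaces and $E,F$ are equivalence relations on $X,Y$ respectively, then $E\le_B F$ ($E$ is Borel reducible to $F$) means that there is a Borel function $\theta:X\to Y$ such that for all $x,\hat x\in X$: $x\,E\,\hat x\iff \theta(x)\,F\,\theta(\hat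 x)$. $E$ and $F$ are Borel incomparable if $E\not\le_B F$ and $F\not\le_B E$. *)

theory Defs
  imports "HOL-Analysis.Analysis"
begin

text \<open>
  Sequence spaces are subsets of the type \<^typ>\<open>nat \<Rightarrow> real\<close>, whose type-class topology is the
  product topology. A space \<open>X\<close> is a carrier set inside a Polish type, with the subspace topology;
  since \<open>restrict_space borel X\<close> is the Borel algebra of that subspace topology, measurability
  between such restrictions is Borel measurability of a map \<open>X \<rightarrow> Y\<close>. Relations on a
  space are sets of pairs.
\<close>

definition unit_sequences :: "(nat \<Rightarrow> real) set" where
  "unit_sequences = (UNIV \<rightarrow> {0..1})"

text \<open>For nonnegative \<open>f\<close>, finiteness of the sum is summability.\<close>

definition E_rel :: "(real \<Rightarrow> real) \<Rightarrow> ((nat \<Rightarrow> real) \<times> (nat \<Rightarrow> real)) set" where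
  "E_rel f = {(x, y). x \<in> unit_sequences \<and> y \<in> unit_sequences \<and>
                      summable (\<lambda>n. f \<bar>y n - x n\<bar>)}"

definition lp_rel :: "real \<Rightarrow> ((nat \<Rightarrow> real) \<times> (nat \<Rightarrow> real)) set" where
  "lp_rel p = {(x, y). summable (\<lambda>n. \<bar>x n - y n\<bar> powr p)}"

definition borel_reducible ::
  "'a::polish_space set \<Rightarrow> ('a \<times> 'a) set \<Rightarrow> 'b::polish_space set \<Rightarrow> ('b \<times> 'b) set \<Rightarrow> bool" where
  "borel_reducible X E Y F \<longleftrightarrow>
     (\<exists>\<theta> \<in> restrict_space borel X \<rightarrow>\<^sub>M restrict_space borel Y.
        \<forall>x\<in>X. \<forall>x'\<in>X. (x, x') \<in> E \<longleftrightarrow> (\<theta> x, \<theta> x') \<in> F)"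

definition borel_incomparable ::
  "'a::polish_space set \<Rightarrow> ('a \<times> 'a) set \<Rightarrow> 'b::polish_space set \<Rightarrow> ('b \<times> 'b) set \<Rightarrow> bool" where
  "borel_incomparable X E Y F \<longleftrightarrow> \<not> borel_reducible X E Y F \<and> \<not> borel_reducible Y F X E"

end

theory Submission
  imports Defs
begin

text \<open>
  The functions are suprema of scaled powers,
  \<open>f\<^sub>A t = (SUP n\<in>A. (1/2) ^ 4 ^ n * t powr (1 + \<delta> / 2 ^ n))\<close> with \<open>0 < \<delta> < \<beta> - 1\<close>, where \<open>A\<close> runs
  through an almost disjoint family of infinite sets of naturals indexed by \<open>\<xi>\<close>. Such an \<open>f\<^sub>A\<close> is
  what is called a gauge below: it is continuous, convex and supermultiplicative, and
  \<open>s powr (1 + \<delta>) * f\<^sub>A r \<le> f\<^sub>A (s * r)\<close>. All that is needed follows from these properties and from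
  the sizes of the values at certain dyadic points.

  Lower bound. Changing the real numbers \<open>x\<^sub>i\<close> by summable amounts does not change their class modulo
  \<open>\<ell>\<^sub>1\<close>, so \<open>x\<^sub>i\<close> may be rounded to a multiple of \<open>g ((1/2) ^ i)\<close>; the distance of two such
  multiples is then reproduced exactly by a step sequence with steps of height \<open>(1/2) ^ i\<close>
  (\<open>l1_reducible\<close>).

  Upper bound. As the exponents stay below \<open>\<beta>\<close>, the sequence
  \<open>m \<mapsto> g ((1/2) ^ m) powr (1 / \<beta>) * sin (2 ^ m * x)\<close> embeds the unit interval into \<open>\<ell>\<^sub>\<beta>\<close> in such a way
  that the \<open>\<beta>\<close>-th power of the norm distance is comparable to \<open>g \<bar>x - y\<bar>\<close> (\<open>reducible_to_lp\<close>).

  Incomparability. If \<open>\<theta>\<close> reduces \<open>E_rel f\<close> to \<open>E_rel g\<close>, restrict it to a product of finite grids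
  \<open>{i / 2 ^ c | i \<le> 2 ^ c}\<close>. Freezing all but infinitely many of the coordinates \<open>c\<close>, one can achieve
  that the output sequence splits into consecutive finite windows, the \<open>k\<close>-th of which depends only on
  the \<open>k\<close>-th free coordinate, up to a summable error (\<open>block_decomposition\<close>). Let \<open>D\<^sub>k u u'\<close> be the
  \<open>g\<close>-distance of the outputs in the \<open>k\<close>-th window when the \<open>k\<close>-th coordinate is \<open>u\<close> or \<open>u'\<close>. Convexity
  and supermultiplicativity bound \<open>g (1 / m) * D\<^sub>k 0 1\<close> by the value of \<open>D\<^sub>k\<close> on one of the \<open>m\<close> steps
  of length \<open>1 / m\<close> from 0 to 1. So if \<open>f\<close> is summable along points \<open>1 / m\<^sub>k\<close> then so is
  \<open>g (1 / m\<^sub>k) * D\<^sub>k 0 1\<close>; if \<open>g\<close> itself is not summable along these points, \<open>D\<^sub>k 0 1\<close> becomes small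
  along a subsequence. Switching infinitely many coordinates from 0 to 1 would then change the
  class modulo \<open>E_rel f\<close> but not the class of the image (\<open>not_reducible\<close>).

  Finally, for \<open>n \<in> B - A\<close> the term with index \<open>n\<close> dominates at a suitable dyadic point \<open>u\<^sub>n\<close> all
  other terms, so that \<open>f\<^sub>A u\<^sub>n \<le> (1/2) ^ n * f\<^sub>B u\<^sub>n\<close>. If \<open>B - A\<close> is infinite, repeating each
  \<open>u\<^sub>n\<close> about \<open>1 / f\<^sub>B u\<^sub>n\<close> times gives a sequence along which \<open>f\<^sub>A\<close> is summable and \<open>f\<^sub>B\<close> is not.
\<close>

section \<open>Summation over pairs\<close>

lemma summable_prod_decode_iff:
  fixes a :: "nat \<Rightarrow> nat \<Rightarrow> real"
  assumes nonneg: "\<And>i j. 0 \<le> a i j"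
  shows "summable (\<lambda>n. a (fst (prod_decode n)) (snd (prod_decode n))) \<longleftrightarrow>
         (\<forall>i. summable (a i)) \<and> summable (\<lambda>i. \<Sum>j. a i j)"
proof -
  let ?A = "\<lambda>p. a (fst p) (snd p)"
  have infsum_eq: "infsum (a i) UNIV = (\<Sum>j. a i j)" if "summable (a i)" for i
    using that nonneg by (intro infsumI norm_summable_imp_has_sum) (auto simp: summable_sums)
  have suminf_nonneg': "0 \<le> (\<Sum>j. a i j)" if "summable (a i)" for i
    using that nonneg by (rule suminf_nonneg)
  have "summable (\<lambda>n. ?A (prod_decode n)) \<longleftrightarrow> (\<lambda>n. ?A (prod_decode n)) summable_on UNIV"
    using nonneg by (intro summable_on_UNIV_nonneg_real_iff[symmetric])
  also have "\<dots> \<longleftrightarrow> ?A summable_on UNIV"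
    by (rule summable_on_reindex_bij_betw[OF bij_prod_decode])
  also have "\<dots> \<longleftrightarrow> (\<lambda>p. norm (?A p)) summable_on (Sigma UNIV (\<lambda>_. UNIV))"
    using nonneg by simp
  also have "\<dots> \<longleftrightarrow> (\<forall>i. a i summable_on UNIV) \<and> (\<lambda>i. norm (infsum (a i) UNIV)) summable_on UNIV"
    using nonneg by (subst Infinite_Sum.abs_summable_on_Sigma_iff) (simp add: infsum_nonneg)
  also have "\<dots> \<longleftrightarrow> (\<forall>i. summable (a i)) \<and> (\<lambda>i. \<Sum>j. a i j) summable_on UNIV"
    using infsum_eq suminf_nonneg' nonneg by (auto simp: summable_on_UNIV_nonneg_real_iff)
  also have "\<dots> \<longleftrightarrow> (\<forall>i. summable (a i)) \<and> summable (\<lambda>i. \<Sum>j. a i j)"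
    using suminf_nonneg' by (auto simp: summable_on_UNIV_nonneg_real_iff)
  finally show ?thesis by simp
qed

text \<open>
  Both positive reductions replace the \<open>i\<close>-th coordinate by a row of a double sequence. This criterion
  lets the row sums be compared with the original terms up to constants and summable errors.
\<close>
lemma summable_prod_decode_comparison:
  fixes a :: "nat \<Rightarrow> nat \<Rightarrow> real"
  assumes "\<And>i j. 0 \<le> a i j" "\<And>i. 0 \<le> b i" "\<And>i. 0 \<le> e i" "summable e" "0 < c"
    and sum: "\<And>i. summable (a i)"
    and lower: "\<And>i. c * b i \<le> (\<Sum>j. a i j) + e i"
    and upper: "\<And>i. (\<Sum>j. a i j) \<le> C * b i + e i"
  shows "summable (\<lambda>n. a (fst (prod_decode n)) (snd (prod_decode n))) \<longleftrightarrow> summable b"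
proof -
  have nonneg: "0 \<le> (\<Sum>j. a i j)" for i using sum assms(1) by (rule suminf_nonneg)
  have "summable b" if "summable (\<lambda>i. \<Sum>j. a i j)"
  proof -
    have "summable (\<lambda>i. c * b i)"
      by (rule summable_comparison_test'[OF summable_add[OF that \<open>summable e\<close>]])
        (use assms lower in auto)
    then show ?thesis using \<open>0 < c\<close> by (simp add: summable_mult_D)
  qed
  moreover have "summable (\<lambda>i. \<Sum>j. a i j)" if "summable b"
    by (rule summable_comparison_test'[OF summable_add[OF summable_mult[OF that, of C] \<open>summable e\<close>]])
      (use nonneg upper in auto)
  ultimately show ?thesis using summable_prod_decode_iff[of a] assms(1) sum by auto
qed

section \<open>Gauges and their equivalence relations\<close>

lemma dist_unit: "x \<in> {0..1} \<Longrightarrow> y \<in> {0..1} \<Longrightarrow> \<bar>x - y\<bar> \<in> {0..(1::real)}"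
  by auto

lemma unit_seqD: "x \<in> unit_sequences \<Longrightarrow> x n \<in> {0..1}"
  by (auto simp: unit_sequences_def)

text \<open>
  The properties of a function \<open>g\<close> that the reductions and the non-reduction use. The scaling condition
  says that the local exponents of \<open>g\<close> do not exceed \<open>q\<close>; convexity says that they are at least 1.
  Supermultiplicativity means that among all scales the oscillation of \<open>g\<close> is steepest at 1:
  \<open>g r / g (r / m) \<le> 1 / g (1 / m)\<close>.
\<close>
locale gauge =
  fixes g :: "real \<Rightarrow> real" and q :: real
  assumes cont: "continuous_on {0..1} g"
    and zero: "g 0 = 0"
    and one_pos: "0 < g 1"
    and one_le: "g 1 \<le> 1"
    and convex: "convex_on {0..1} g"
    and q_nonneg: "0 \<le> q"
    and scaling: "\<And>s r. s \<in> {0..1} \<Longrightarrow> r \<in> {0..1} \<Longrightarrow> s powr q * g r \<le> g (s * r)"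
    and supermult: "\<And>s r. s \<in> {0..1} \<Longrightarrow> r \<in> {0..1} \<Longrightarrow> g s * g r \<le> g (s * r)"
begin

lemma nonneg: "t \<in> {0..1} \<Longrightarrow> 0 \<le> g t"
  using scaling[of t 1] one_pos by (auto intro: order_trans[rotated])

lemma pos:
  assumes "0 < t" "t \<le> 1"
  shows "0 < g t"
proof -
  have "0 < t powr q * g 1" using assms one_pos by simp
  also have "\<dots> \<le> g t" using scaling[of t 1] assms by simp
  finally show ?thesis .
qed

lemma sub_linear: "s \<in> {0..1} \<Longrightarrow> r \<in> {0..1} \<Longrightarrow> g (s * r) \<le> s * g r"
  using convex_onD[OF convex, of s 0 r] zero by simp

lemma le_self: "t \<in> {0..1} \<Longrightarrow> g t \<le> t"
  using sub_linear[of t 1] one_le mult_left_mono[of "g 1" 1 t] by auto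

lemma mono:
  assumes "0 \<le> s" "s \<le> r" "r \<le> 1"
  shows "g s \<le> g r"
proof (cases "r = 0")
  case False
  then have "g s \<le> (s / r) * g r" using sub_linear[of "s / r" r] assms by simp
  also have "\<dots> \<le> 1 * g r" using assms nonneg[of r] False by (intro mult_right_mono) auto
  finally show ?thesis by simp
qed (use assms in auto)

text \<open>One of the two shorter distances is at least half the long one, and halving costs \<open>2 powr q\<close>.\<close>
lemma weak_triangle:
  assumes "x \<in> {0..1}" "y \<in> {0..1}" "z \<in> {0..1}"
  shows "g \<bar>x - z\<bar> \<le> 2 powr q * (g \<bar>x - y\<bar> + g \<bar>y - z\<bar>)"
proof -
  let ?t = "\<bar>x - z\<bar>"
  have half: "g ?t \<le> 2 powr q * g (?t / 2)"
    using scaling[of "1/2" ?t] assms by (simp add: powr_divide field_simps abs_le_iff)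
  have "?t \<le> \<bar>x - y\<bar> + \<bar>y - z\<bar>" by linarith
  then have "?t / 2 \<le> \<bar>x - y\<bar> \<or> ?t / 2 \<le> \<bar>y - z\<bar>" by argo
  then have "g (?t / 2) \<le> g \<bar>x - y\<bar> + g \<bar>y - z\<bar>"
  proof
    assume "?t / 2 \<le> \<bar>x - y\<bar>"
    then have "g (?t / 2) \<le> g \<bar>x - y\<bar>" using assms by (intro mono) auto
    then show ?thesis using nonneg[OF dist_unit[OF assms(2,3)]] by linarith
  next
    assume "?t / 2 \<le> \<bar>y - z\<bar>"
    then have "g (?t / 2) \<le> g \<bar>y - z\<bar>" using assms by (intro mono) auto
    then show ?thesis using nonneg[OF dist_unit[OF assms(1,2)]] by linarith
  qed
  then have "2 powr q * g (?t / 2) \<le> 2 powr q * (g \<bar>x - y\<bar> + g \<bar>y - z\<bar>)"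
    by (intro mult_left_mono) auto
  then show ?thesis using half by linarith
qed

lemma equiv_E_rel: "equiv unit_sequences (E_rel g)"
proof (rule equivI)
  show "E_rel g \<subseteq> unit_sequences \<times> unit_sequences" by (auto simp: E_rel_def)
  show "refl_on unit_sequences (E_rel g)"
    by (auto simp: refl_on_def E_rel_def zero)
  show "sym (E_rel g)" by (auto simp: sym_def E_rel_def abs_minus_commute)
  show "trans (E_rel g)"
  proof (rule transI)
    fix x y z assume xy: "(x, y) \<in> E_rel g" and yz: "(y, z) \<in> E_rel g"
    then have u: "x n \<in> {0..1}" "y n \<in> {0..1}" "z n \<in> {0..1}" for n
      by (simp_all add: E_rel_def unit_seqD del: atLeastAtMost_iff)
    have "summable (\<lambda>n. 2 powr q * (g \<bar>z n - y n\<bar> + g \<bar>y n - x n\<bar>))"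
      using xy yz by (intro summable_mult summable_add) (auto simp: E_rel_def)
    then have "summable (\<lambda>n. g \<bar>z n - x n\<bar>)"
      by (rule summable_comparison_test')
        (use weak_triangle[OF u(3) u(2) u(1)] nonneg[OF dist_unit[OF u(3) u(1)]] in auto)
    then show "(x, z) \<in> E_rel g" using xy yz by (simp add: E_rel_def)
  qed
qed

end

section \<open>Reductions from and to the l-p equivalence relations\<close>

lemma measurable_coordinate_real [measurable]: "(\<lambda>x::nat \<Rightarrow> real. x i) \<in> borel_measurable borel"
  by (rule measurable_product_coordinates)

context gauge
begin

text \<open>
  The step sequences of two integers differ exactly at the integers between them, so an arbitrary
  integer distance is counted out in units of \<open>g t\<close>.
\<close>
lemma floor_step_sums:
  fixes x y :: real
  assumes "0 < t" "t \<le> 1"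
  shows "(\<lambda>j. g \<bar>(if int_decode j < \<lfloor>y\<rfloor> then t else 0) - (if int_decode j < \<lfloor>x\<rfloor> then t else 0)\<bar>)
           sums (g t * \<bar>of_int \<lfloor>y\<rfloor> - of_int \<lfloor>x\<rfloor>\<bar>)"
proof -
  let ?I = "{min \<lfloor>x\<rfloor> \<lfloor>y\<rfloor>..<max \<lfloor>x\<rfloor> \<lfloor>y\<rfloor>}"
  let ?h = "\<lambda>j. g \<bar>(if int_decode j < \<lfloor>y\<rfloor> then t else 0) - (if int_decode j < \<lfloor>x\<rfloor> then t else 0)\<bar>"
  have eq: "?h j = (if j \<in> int_encode ` ?I then g t else 0)" for j
  proof -
    have "j \<in> int_encode ` ?I \<longleftrightarrow> int_decode j \<in> ?I"
      by (metis image_iff int_decode_inverse int_encode_inverse)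
    then show ?thesis using assms by (auto simp: zero)
  qed
  have "?h sums (\<Sum>j\<in>int_encode ` ?I. g t)"
    unfolding eq by (intro sums_If_finite_set) auto
  also have "(\<Sum>j\<in>int_encode ` ?I. g t) = g t * card (int_encode ` ?I)" by simp
  also have "card (int_encode ` ?I) = card ?I" by (intro card_image inj_int_encode)
  also have "real (card ?I) = \<bar>of_int \<lfloor>y\<rfloor> - of_int \<lfloor>x\<rfloor>\<bar>" by (auto simp: min_def max_def)
  finally show ?thesis .
qed

text \<open>
  Rounding \<open>x i\<close> down to a multiple of \<open>g ((1/2) ^ i)\<close> moves it by at most \<open>(1/2) ^ i\<close>, hence keeps its
  class modulo \<open>\<ell>\<^sub>1\<close>; the rounded numbers are encoded isometrically by \<open>floor_step_sums\<close>.
\<close>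
theorem l1_reducible: "borel_reducible UNIV (lp_rel 1) unit_sequences (E_rel g)"
proof -
  let ?t = "\<lambda>i. (1/2)^i :: real"
  let ?q = "\<lambda>i. g (?t i)"
  define \<theta> :: "(nat \<Rightarrow> real) \<Rightarrow> nat \<Rightarrow> real" where
    "\<theta> x n = (case prod_decode n of (i, j) \<Rightarrow> if int_decode j < \<lfloor>x i / ?q i\<rfloor> then ?t i else 0)" for x n
  have t: "0 < ?t i" "?t i \<le> 1" for i by (auto simp: power_le_one)
  have qpos: "0 < ?q i" for i using t by (rule pos)
  have meas: "(\<lambda>x. \<theta> x n) \<in> borel_measurable borel" for n
    unfolding \<theta>_def by (cases "prod_decode n") simp
  have unit: "\<theta> x \<in> unit_sequences" for x
    using t by (auto simp: unit_sequences_def \<theta>_def less_imp_le split: prod.split)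
  have "\<theta> \<in> restrict_space borel UNIV \<rightarrow>\<^sub>M restrict_space borel unit_sequences"
    using measurable_coordinatewise_then_product[of \<theta>, OF meas] unit
    by (intro measurable_restrict_space2 measurable_restrict_space1) auto
  moreover have "(x, y) \<in> lp_rel 1 \<longleftrightarrow> (\<theta> x, \<theta> y) \<in> E_rel g" for x y
  proof -
    define a where "a i j = g \<bar>(if int_decode j < \<lfloor>y i / ?q i\<rfloor> then ?t i else 0) -
      (if int_decode j < \<lfloor>x i / ?q i\<rfloor> then ?t i else 0)\<bar>" for i j
    have a_sums: "a i sums (?q i * \<bar>of_int \<lfloor>y i / ?q i\<rfloor> - of_int \<lfloor>x i / ?q i\<rfloor>\<bar>)" for i
      unfolding a_def using t by (rule floor_step_sums)
    have near: "\<bar>?q i * \<bar>of_int \<lfloor>y i / ?q i\<rfloor> - of_int \<lfloor>x i / ?q i\<rfloor>\<bar> - \<bar>x i - y i\<bar>\<bar> \<le> ?t i" for i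
    proof -
      let ?u = "x i / ?q i" and ?v = "y i / ?q i"
      have "\<bar>\<bar>of_int \<lfloor>?v\<rfloor> - of_int \<lfloor>?u\<rfloor>\<bar> - \<bar>?u - ?v\<bar>\<bar> \<le> 1" by linarith
      then have "?q i * \<bar>\<bar>of_int \<lfloor>?v\<rfloor> - of_int \<lfloor>?u\<rfloor>\<bar> - \<bar>?u - ?v\<bar>\<bar> \<le> ?q i * 1"
        using qpos[of i] by (intro mult_left_mono) auto
      moreover have "?q i * ?u = x i" "?q i * ?v = y i" using qpos[of i] by auto
      then have "?q i * \<bar>?u - ?v\<bar> = \<bar>x i - y i\<bar>"
        using qpos[of i] by (subst abs_mult_pos') (auto simp: right_diff_distrib)
      then have "?q i * \<bar>\<bar>of_int \<lfloor>?v\<rfloor> - of_int \<lfloor>?u\<rfloor>\<bar> - \<bar>?u - ?v\<bar>\<bar> =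
          \<bar>?q i * \<bar>of_int \<lfloor>?v\<rfloor> - of_int \<lfloor>?u\<rfloor>\<bar> - \<bar>x i - y i\<bar>\<bar>"
        using qpos[of i] by (subst abs_mult_pos') (auto simp: right_diff_distrib)
      moreover have "?q i \<le> ?t i" using t[of i] by (intro le_self) auto
      ultimately show ?thesis by linarith
    qed
    have "summable (\<lambda>n. a (fst (prod_decode n)) (snd (prod_decode n))) \<longleftrightarrow>
        summable (\<lambda>i. \<bar>x i - y i\<bar>)"
    proof (rule summable_prod_decode_comparison[where c = 1 and C = 1 and e = ?t])
      show "0 \<le> a i j" for i j unfolding a_def using t[of i] by (intro nonneg) auto
      show "summable ?t" by (simp add: summable_geometric)
      show "1 * \<bar>x i - y i\<bar> \<le> (\<Sum>j. a i j) + ?t i" "(\<Sum>j. a i j) \<le> 1 * \<bar>x i - y i\<bar> + ?t i" for i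
        using near[of i, THEN abs_diff_le_iff[THEN iffD1]] sums_unique[OF a_sums[of i], symmetric]
        by simp_all
    qed (use a_sums in \<open>auto simp: sums_iff\<close>)
    moreover have "g \<bar>\<theta> y n - \<theta> x n\<bar> = a (fst (prod_decode n)) (snd (prod_decode n))" for n
      by (simp add: \<theta>_def a_def split: prod.split)
    ultimately show ?thesis using unit by (simp add: E_rel_def lp_rel_def)
  qed
  ultimately show ?thesis unfolding borel_reducible_def by blast
qed

lemma sin_ge_sin_half:
  assumes "1/2 \<le> t" "t \<le> 2"
  shows "sin (1/2) \<le> sin (t::real)"
proof (cases "t \<le> pi / 2")
  case True
  then show ?thesis using assms by (intro sin_mono_le_eq[THEN iffD2]) auto
next
  case False
  have "sin (1/2) \<le> sin (pi - t)"
    using False assms pi_gt3 by (intro sin_mono_le_eq[THEN iffD2]) auto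
  then show ?thesis by simp
qed

lemma abs_sin_diff_le: "\<bar>sin x - sin y\<bar> \<le> \<bar>x - y\<bar>" for x y :: real
proof -
  have "\<bar>sin ((x - y) / 2)\<bar> * \<bar>cos ((x + y) / 2)\<bar> \<le> \<bar>(x - y) / 2\<bar> * 1"
    by (intro mult_mono abs_sin_x_le_abs_x abs_cos_le_one) auto
  then show ?thesis by (simp add: sin_diff_sin abs_mult)
qed

text \<open>
  By itself \<open>sin (2 ^ N * x) - sin (2 ^ N * y) = 2 * sin h * cos u\<close> may vanish through the factor
  \<open>cos u\<close>, although \<open>h\<close> is bounded away from the zeros of the sine. Passing from \<open>N\<close> to \<open>N + 1\<close> doubles
  \<open>u\<close>, so one of two consecutive scales always separates the points.
\<close>
lemma one_lacunary_sine_separates: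
  fixes x y :: real
  assumes N: "1 \<le> 2 ^ N * \<bar>x - y\<bar>" "2 ^ N * \<bar>x - y\<bar> \<le> 2"
  shows "\<exists>m\<in>{N, Suc N}. sin (1/2) \<le> \<bar>sin (2 ^ m * x) - sin (2 ^ m * y)\<bar>"
proof -
  define h u where "h = 2 ^ N * (x - y) / 2" and "u = 2 ^ N * (x + y) / 2"
  have h: "1/2 \<le> \<bar>h\<bar>" "\<bar>h\<bar> \<le> 1" using N by (auto simp: h_def abs_mult)
  have "sin (2 ^ N * x) - sin (2 ^ N * y) = 2 * sin h * cos u"
    unfolding h_def u_def sin_diff_sin by (simp add: algebra_simps)
  then have 1: "\<bar>sin (2 ^ N * x) - sin (2 ^ N * y)\<bar> = 2 * \<bar>sin h\<bar> * \<bar>cos u\<bar>"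
    by (simp add: abs_mult)
  have "sin (2 ^ Suc N * x) - sin (2 ^ Suc N * y) = 2 * sin (2 * h) * cos (2 * u)"
    unfolding h_def u_def sin_diff_sin by (simp add: algebra_simps)
  then have 2: "\<bar>sin (2 ^ Suc N * x) - sin (2 ^ Suc N * y)\<bar> = 2 * \<bar>sin (2 * h)\<bar> * \<bar>cos (2 * u)\<bar>"
    by (simp add: abs_mult)
  have abs_sin: "sin (1/2) \<le> \<bar>sin t\<bar>" if "1/2 \<le> \<bar>t\<bar>" "\<bar>t\<bar> \<le> 2" for t :: real
    using sin_ge_sin_half[OF that] by (auto simp: abs_if split: if_splits)
  have pos: "0 < sin (1/2::real)" using pi_gt3 by (intro sin_gt_zero) auto
  \<comment> \<open>By the double-angle formula, \<open>cos u\<close> and \<open>cos (2 * u)\<close> cannot both be small.\<close>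
  show ?thesis
  proof (cases "1/2 \<le> \<bar>cos u\<bar>")
    case True
    have "sin (1/2) * (1/2) \<le> \<bar>sin h\<bar> * \<bar>cos u\<bar>"
      using abs_sin[of h] h True pos by (intro mult_mono) auto
    then show ?thesis using 1 by auto
  next
    case False
    then have "(cos u)\<^sup>2 \<le> (1/2)\<^sup>2"
      by (intro abs_le_square_iff[THEN iffD1]) auto
    then have "1/2 \<le> \<bar>cos (2 * u)\<bar>"
      unfolding cos_double_cos by (simp add: power2_eq_square)
    then have "sin (1/2) * (1/2) \<le> \<bar>sin (2 * h)\<bar> * \<bar>cos (2 * u)\<bar>"
      using abs_sin[of "2 * h"] h pos by (intro mult_mono) auto
    then show ?thesis using 2 by auto
  qed
qed

lemma two_sided_geometric:
  fixes \<rho> :: real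
  assumes "0 < \<rho>" "\<rho> < 1"
  shows "summable (\<lambda>m. \<rho> ^ (if m \<le> N then N - m else m - N))"
    and "(\<Sum>m. \<rho> ^ (if m \<le> N then N - m else m - N)) \<le> 2 / (1 - \<rho>)"
proof -
  let ?f = "\<lambda>m. \<rho> ^ (if m \<le> N then N - m else m - N)"
  have geo: "summable (\<lambda>m. \<rho> ^ m)" "(\<Sum>m. \<rho> ^ m) = 1 / (1 - \<rho>)"
    using assms by (auto simp: summable_geometric suminf_geometric)
  have shift: "?f (m + N) = \<rho> ^ m" for m by simp
  show summ: "summable ?f"
    using summable_iff_shift[of ?f N] geo(1) unfolding shift by simp
  have "(\<Sum>m<N. ?f m) = (\<Sum>m<N. \<rho> ^ Suc (N - Suc m))"
    by (intro sum.cong) (auto simp del: power_Suc simp: Suc_diff_Suc)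
  also have "\<dots> = (\<Sum>m<N. \<rho> ^ Suc m)" by (rule sum.nat_diff_reindex)
  also have "\<dots> \<le> (\<Sum>m<N. \<rho> ^ m)"
    using assms by (intro sum_mono power_decreasing) auto
  also have "\<dots> \<le> (\<Sum>m. \<rho> ^ m)" using geo(1) assms by (intro sum_le_suminf) auto
  finally show "suminf ?f \<le> 2 / (1 - \<rho>)"
    using suminf_split_initial_segment[OF summ, of N] geo(2) unfolding shift by simp
qed

lemma obtain_dyadic_scale:
  assumes "0 < d" "d \<le> (1::real)"
  obtains N where "1 \<le> 2 ^ N * d" "2 ^ N * d \<le> 2"
proof -
  obtain n where "1 / d < 2 ^ n" using real_arch_pow[of 2 "1/d"] by auto
  then have ex: "1 \<le> 2 ^ n * d" using assms by (simp add: field_simps)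
  define N where "N = (LEAST n. 1 \<le> 2 ^ n * d)"
  have 1: "1 \<le> 2 ^ N * d" unfolding N_def by (rule LeastI[of _ n]) (rule ex)
  have "2 ^ N * d \<le> 2"
  proof (cases N)
    case (Suc k)
    then have "\<not> 1 \<le> 2 ^ k * d" using not_less_Least[of k "\<lambda>n. 1 \<le> 2 ^ n * d"] by (simp add: N_def)
    then show ?thesis using Suc by simp
  qed (use assms in simp)
  then show thesis using 1 that by blast
qed

text \<open>
  With \<open>d = \<bar>x - y\<bar>\<close> and \<open>2 ^ N\<close> of the order of \<open>1 / d\<close>, the terms decrease geometrically on both sides of
  \<open>N\<close>. For \<open>m < N\<close> the sine is Lipschitz and gives \<open>(2 ^ m * d) powr \<beta>\<close>, which wins against the
  scaling exponent \<open>q < \<beta>\<close>; for \<open>m \<ge> N\<close> the sine is merely bounded and the decay comes from \<open>g\<close>. The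
  lower bound needs a single term of index \<open>N\<close> or \<open>N + 1\<close>.
\<close>
lemma sine_embedding:
  fixes x y :: real
  assumes "q < \<beta>" and xy: "x \<in> {0..1}" "y \<in> {0..1}"
  defines "a \<equiv> \<lambda>m::nat. g ((1/2) ^ m) * \<bar>sin (2 ^ m * x) - sin (2 ^ m * y)\<bar> powr \<beta>"
    and "\<rho> \<equiv> max (1/2) (2 powr (q - \<beta>))"
  shows "summable a"
    and "(1/4) powr q * sin (1/2) powr \<beta> * g \<bar>x - y\<bar> \<le> suminf a"
    and "suminf a \<le> 2 powr \<beta> * (2 / (1 - \<rho>)) * g \<bar>x - y\<bar>"
proof -
  have half_pow: "(1/2::real) ^ m \<in> {0..1}" for m by (auto simp: power_le_one)
  have a_nonneg: "0 \<le> a m" for m unfolding a_def by (intro mult_nonneg_nonneg nonneg half_pow) auto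
  have *: "summable a \<and> (1/4) powr q * sin (1/2) powr \<beta> * g \<bar>x - y\<bar> \<le> suminf a \<and>
    suminf a \<le> 2 powr \<beta> * (2 / (1 - \<rho>)) * g \<bar>x - y\<bar>"
  proof (cases "x = y")
    case True
    then have "a = (\<lambda>_. 0)" by (simp add: a_def)
    then show ?thesis using True zero by simp
  next
    case False
    define d where "d = \<bar>x - y\<bar>"
    have d: "0 < d" "d \<le> 1" using False xy by (auto simp: d_def)
    obtain N where N: "1 \<le> 2 ^ N * d" "2 ^ N * d \<le> 2" using d by (rule obtain_dyadic_scale)
    have \<rho>: "0 < \<rho>" "\<rho> < 1" using \<open>q < \<beta>\<close> by (auto simp: \<rho>_def powr_less_one)
    let ?r = "\<lambda>m. \<rho> ^ (if m \<le> N then N - m else m - N)"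
    have bound: "a m \<le> 2 powr \<beta> * g d * ?r m" for m
    proof (cases "m < N")
      case True
      define s where "s = 2 ^ m * d"
      have s_eq: "s = 2 ^ N * d * (1/2) ^ (N - m)"
        using True by (simp add: s_def power_diff field_simps)
      have s: "0 < s" "s \<le> 2 * (1/2) ^ (N - m)"
        using d N(2) mult_right_mono[OF N(2), of "(1/2) ^ (N - m)"] s_eq by (auto simp: s_def)
      have "(1/2::real) ^ (N - m) \<le> (1/2) ^ 1" using True by (intro power_decreasing) auto
      then have s1: "s \<le> 1" using s by simp
      have "\<bar>sin (2 ^ m * x) - sin (2 ^ m * y)\<bar> \<le> \<bar>2 ^ m * x - 2 ^ m * y\<bar>"
        by (rule abs_sin_diff_le)
      also have "\<dots> = s" by (simp add: s_def d_def right_diff_distrib[symmetric] abs_mult)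
      finally have "\<bar>sin (2 ^ m * x) - sin (2 ^ m * y)\<bar> powr \<beta> \<le> s powr \<beta>"
        using \<open>q < \<beta>\<close> q_nonneg by (intro powr_mono2) auto
      then have "a m \<le> g ((1/2) ^ m) * s powr \<beta>"
        unfolding a_def by (intro mult_left_mono nonneg half_pow)
      also have "\<dots> = s powr q * g ((1/2) ^ m) * s powr (\<beta> - q)"
        by (simp add: powr_add[symmetric])
      also have "s powr q * g ((1/2) ^ m) \<le> g (s * (1/2) ^ m)"
        using s s1 half_pow by (intro scaling) auto
      also have "s * (1/2) ^ m = d" by (simp add: s_def power_divide)
      finally have 1: "a m \<le> g d * s powr (\<beta> - q)" by (simp add: mult_right_mono)
      have "s powr (\<beta> - q) \<le> (2 * (1/2) ^ (N - m)) powr (\<beta> - q)"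
        using s \<open>q < \<beta>\<close> by (intro powr_mono2) auto
      also have "\<dots> = 2 powr (\<beta> - q) * (2 powr (q - \<beta>)) ^ (N - m)"
      proof -
        have "((1/2::real) ^ (N - m)) powr (\<beta> - q) = ((1/2) powr (\<beta> - q)) ^ (N - m)"
          by (simp add: powr_realpow[symmetric] powr_powr powr_power mult.commute)
        also have "(1/2::real) powr (\<beta> - q) = 2 powr (q - \<beta>)"
          by (simp add: powr_divide powr_diff)
        finally show ?thesis by (simp add: powr_mult)
      qed
      also have "\<dots> \<le> 2 powr \<beta> * \<rho> ^ (N - m)"
        using q_nonneg \<rho> by (intro mult_mono power_mono) (auto simp: \<rho>_def)
      finally have "g d * s powr (\<beta> - q) \<le> g d * (2 powr \<beta> * \<rho> ^ (N - m))"
        using d nonneg by (intro mult_left_mono) auto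
      then show ?thesis using 1 True by (simp add: mult_ac)
    next
      case False
      define s where "s = 1 / (2 ^ m * d)"
      have "1 * 2 ^ (m - N) \<le> 2 ^ N * d * 2 ^ (m - N)" using N by (intro mult_right_mono) auto
      also have "\<dots> = 2 ^ m * d" using False by (simp add: power_add[symmetric])
      finally have s: "0 < s" "s \<le> (1/2) ^ (m - N)"
        using d by (auto simp: s_def power_divide field_simps)
      then have s1: "s \<le> 1" using half_pow[of "m - N"] by auto
      have "\<bar>sin (2 ^ m * x) - sin (2 ^ m * y)\<bar> \<le> 2"
        using abs_sin_le_one[of "2 ^ m * x"] abs_sin_le_one[of "2 ^ m * y"] by linarith
      then have "\<bar>sin (2 ^ m * x) - sin (2 ^ m * y)\<bar> powr \<beta> \<le> 2 powr \<beta>"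
        using \<open>q < \<beta>\<close> q_nonneg by (intro powr_mono2) auto
      then have "a m \<le> g ((1/2) ^ m) * 2 powr \<beta>"
        unfolding a_def by (intro mult_left_mono nonneg half_pow)
      also have "(1/2) ^ m = s * d" using d by (simp add: s_def power_divide)
      also have "g (s * d) \<le> s * g d" using s s1 d by (intro sub_linear) auto
      also have "s * g d \<le> \<rho> ^ (m - N) * g d"
      proof (intro mult_right_mono)
        have "(1/2) ^ (m - N) \<le> \<rho> ^ (m - N)" by (intro power_mono) (auto simp: \<rho>_def)
        then show "s \<le> \<rho> ^ (m - N)" using s by simp
      qed (use d nonneg in auto)
      finally have "a m \<le> 2 powr \<beta> * g d * \<rho> ^ (m - N)" by (simp add: mult_ac)
      moreover have "?r m = \<rho> ^ (m - N)" using False by auto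
      ultimately show ?thesis by simp
    qed
    have summ_r: "summable (\<lambda>m. 2 powr \<beta> * g d * ?r m)"
      using two_sided_geometric(1)[OF \<rho>] by (rule summable_mult)
    have summ: "summable a"
      by (rule summable_comparison_test'[OF summ_r]) (use a_nonneg bound in auto)
    have "suminf a \<le> (\<Sum>m. 2 powr \<beta> * g d * ?r m)" using bound summ summ_r by (rule suminf_le)
    also have "\<dots> = 2 powr \<beta> * g d * suminf ?r"
      using two_sided_geometric(1)[OF \<rho>] by (rule suminf_mult)
    also have "\<dots> \<le> 2 powr \<beta> * g d * (2 / (1 - \<rho>))"
      using two_sided_geometric(2)[OF \<rho>] d nonneg by (intro mult_left_mono) auto
    finally have upper: "suminf a \<le> 2 powr \<beta> * (2 / (1 - \<rho>)) * g d" by (simp add: mult_ac)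
    obtain m where m: "m = N \<or> m = Suc N" "sin (1/2) \<le> \<bar>sin (2 ^ m * x) - sin (2 ^ m * y)\<bar>"
      using one_lacunary_sine_separates[of N x y] N unfolding d_def by blast
    have "(1/4) powr q * g d \<le> g ((1/4) * d)" using d by (intro scaling) auto
    also have "\<dots> \<le> g ((1/2) ^ m)"
    proof (intro mono)
      have "d \<le> 2 * (1/2) ^ N" using N(2) by (simp add: power_divide field_simps)
      then show "1/4 * d \<le> (1/2) ^ m" using m(1) d by auto
    qed (use d half_pow[of m] in auto)
    finally have 1: "(1/4) powr q * g d \<le> g ((1/2) ^ m)" .
    have sin_pos: "0 < sin (1/2::real)" using pi_gt3 by (intro sin_gt_zero) auto
    have "sin (1/2) powr \<beta> \<le> \<bar>sin (2 ^ m * x) - sin (2 ^ m * y)\<bar> powr \<beta>"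
      using m(2) sin_pos \<open>q < \<beta>\<close> q_nonneg by (intro powr_mono2) auto
    then have "(1/4) powr q * g d * sin (1/2) powr \<beta> \<le> a m"
      unfolding a_def using 1 nonneg[OF half_pow] by (intro mult_mono) auto
    also have "\<dots> \<le> suminf a"
      using sum_le_suminf[OF summ, of "{m}"] a_nonneg by simp
    finally show ?thesis using summ upper by (simp add: d_def mult_ac)
  qed
  then show "summable a" "(1/4) powr q * sin (1/2) powr \<beta> * g \<bar>x - y\<bar> \<le> suminf a"
    "suminf a \<le> 2 powr \<beta> * (2 / (1 - \<rho>)) * g \<bar>x - y\<bar>" by blast+
qed

theorem reducible_to_lp:
  assumes "q < \<beta>"
  shows "borel_reducible unit_sequences (E_rel g) UNIV (lp_rel \<beta>)"
proof -
  define w where "w m = g ((1/2) ^ m)" for m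
  have w: "0 \<le> w m" for m unfolding w_def by (intro nonneg) (auto simp: power_le_one)
  define \<theta> :: "(nat \<Rightarrow> real) \<Rightarrow> nat \<Rightarrow> real" where
    "\<theta> x n = (case prod_decode n of (i, m) \<Rightarrow> w m powr (1 / \<beta>) * sin (2 ^ m * x i))" for x n
  have meas: "(\<lambda>x. \<theta> x n) \<in> borel_measurable borel" for n
    unfolding \<theta>_def by (cases "prod_decode n") simp
  have "\<theta> \<in> restrict_space borel unit_sequences \<rightarrow>\<^sub>M restrict_space borel UNIV"
    using measurable_coordinatewise_then_product[of \<theta>, OF meas]
    by (intro measurable_restrict_space2 measurable_restrict_space1) auto
  moreover have "(x, y) \<in> E_rel g \<longleftrightarrow> (\<theta> x, \<theta> y) \<in> lp_rel \<beta>"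
    if xy: "x \<in> unit_sequences" "y \<in> unit_sequences" for x y
  proof -
    define a where "a i m = w m * \<bar>sin (2 ^ m * x i) - sin (2 ^ m * y i)\<bar> powr \<beta>" for i m
    note emb = sine_embedding[OF assms unit_seqD[OF xy(1)] unit_seqD[OF xy(2)], folded w_def, folded a_def]
    have "summable (\<lambda>n. a (fst (prod_decode n)) (snd (prod_decode n))) \<longleftrightarrow>
        summable (\<lambda>i. g \<bar>x i - y i\<bar>)"
    proof (rule summable_prod_decode_comparison[where e = "\<lambda>_. 0"])
      show "0 \<le> a i m" for i m using w by (simp add: a_def)
      show "0 \<le> g \<bar>x i - y i\<bar>" for i
        using xy by (intro nonneg dist_unit unit_seqD)
      show "summable (a i)" for i using emb(1)[of i i] unfolding a_def .
      show "0 < (1/4) powr q * sin (1/2::real) powr \<beta>"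
        using sin_gt_zero[of "1/2"] pi_gt3 by simp
      show "(1/4) powr q * sin (1/2) powr \<beta> * g \<bar>x i - y i\<bar> \<le> suminf (a i) + 0" for i
        using emb(2)[of i i] unfolding a_def by simp
      show "suminf (a i) \<le> 2 powr \<beta> * (2 / (1 - max (1/2) (2 powr (q - \<beta>)))) * g \<bar>x i - y i\<bar> + 0" for i
        using emb(3)[of i i] unfolding a_def by simp
    qed auto
    moreover have "\<bar>\<theta> x n - \<theta> y n\<bar> powr \<beta> = a (fst (prod_decode n)) (snd (prod_decode n))" for n
    proof -
      obtain i m where n: "prod_decode n = (i, m)" by (cases "prod_decode n")
      have "\<bar>\<theta> x n - \<theta> y n\<bar> = w m powr (1 / \<beta>) * \<bar>sin (2 ^ m * x i) - sin (2 ^ m * y i)\<bar>"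
        by (simp add: \<theta>_def n right_diff_distrib[symmetric] abs_mult)
      then show ?thesis using assms q_nonneg w[of m] by (simp add: a_def n powr_mult powr_powr)
    qed
    ultimately show ?thesis using xy by (simp add: E_rel_def lp_rel_def abs_minus_commute)
  qed
  ultimately show ?thesis unfolding borel_reducible_def by blast
qed

end

section \<open>Cubes, homogeneous sets and fusion\<close>

text \<open>
  Points are sequences of naturals with \<open>x c \<le> M c\<close>. A cube \<open>cube F z\<close> leaves the coordinates in the
  infinite set \<open>F\<close> free and freezes all others at the values of \<open>z\<close>; shrinking it to a subcube freezes
  more coordinates. These are the conditions of Silver forcing for a product of finite sets.
\<close>
locale finite_product =
  fixes M :: "nat \<Rightarrow> nat"
begin

definition grid :: "(nat \<Rightarrow> nat) set" where
  "grid = {x. \<forall>c. x c \<le> M c}"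

definition cube :: "nat set \<Rightarrow> (nat \<Rightarrow> nat) \<Rightarrow> (nat \<Rightarrow> nat) set" where
  "cube F z = {x \<in> grid. \<forall>c. c \<notin> F \<longrightarrow> x c = z c}"

definition subcube :: "nat set \<Rightarrow> (nat \<Rightarrow> nat) \<Rightarrow> nat set \<Rightarrow> (nat \<Rightarrow> nat) \<Rightarrow> bool" where
  "subcube F z F' z' \<longleftrightarrow> infinite F' \<and> F' \<subseteq> F \<and> z' \<in> cube F z"

text \<open>
  The analogue of being completely Ramsey. The homogeneous sets turn out to form a \<open>\<sigma>\<close>-algebra, so
  that Borel sets can be decided on subcubes without any appeal to Baire category.
\<close>
definition homogeneous :: "(nat \<Rightarrow> nat) set \<Rightarrow> bool" where
  "homogeneous B \<longleftrightarrow> (\<forall>F z. infinite F \<longrightarrow> z \<in> grid \<longrightarrow>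
     (\<exists>F' z'. subcube F z F' z' \<and> (cube F' z' \<subseteq> B \<or> cube F' z' \<inter> B = {})))"

lemma cube_subset_grid: "cube F z \<subseteq> grid"
  by (auto simp: cube_def)

lemma base_in_cube: "z \<in> grid \<Longrightarrow> z \<in> cube F z"
  by (auto simp: cube_def)

lemma cube_mono: "subcube F z F' z' \<Longrightarrow> cube F' z' \<subseteq> cube F z"
  by (auto simp: cube_def subcube_def)

lemma subcube_refl: "infinite F \<Longrightarrow> z \<in> grid \<Longrightarrow> subcube F z F z"
  by (auto simp: subcube_def base_in_cube)

lemma subcube_trans: "subcube F z F' z' \<Longrightarrow> subcube F' z' F'' z'' \<Longrightarrow> subcube F z F'' z''"
  by (auto simp: cube_def subcube_def)

lemma subcubeD:
  assumes "subcube F z F' z'"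
  shows "infinite F'" "F' \<subseteq> F" "z' \<in> cube F z" "z' \<in> grid"
  using assms by (auto simp: subcube_def cube_def)

lemma subcube_finite_conj:
  assumes "finite A" "infinite F" "z \<in> grid"
    and dense: "\<And>a F' z'. a \<in> A \<Longrightarrow> subcube F z F' z' \<Longrightarrow>
       \<exists>F'' z''. subcube F' z' F'' z'' \<and> P a (cube F'' z'')"
    and antimono: "\<And>a X Y. P a X \<Longrightarrow> Y \<subseteq> X \<Longrightarrow> P a Y"
  shows "\<exists>F' z'. subcube F z F' z' \<and> (\<forall>a\<in>A. P a (cube F' z'))"
  using assms(1) dense
proof (induction A rule: finite_induct)
  case empty
  then show ?case using subcube_refl[OF assms(2,3)] by blast
next
  case (insert a A)
  then obtain F' z' where 1: "subcube F z F' z'" "\<forall>a\<in>A. P a (cube F' z')" by blast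
  then obtain F'' z'' where 2: "subcube F' z' F'' z''" "P a (cube F'' z'')"
    using insert.prems by blast
  have "subcube F z F'' z''" using 1 2 subcube_trans by blast
  moreover have "\<forall>a\<in>A. P a (cube F'' z'')" using 1 2 cube_mono antimono by blast
  ultimately show ?case using 2 by blast
qed

text \<open>
  Infinitely many shrinking steps cannot be carried out on one cube, as no free coordinate might
  remain. Instead, before step \<open>k\<close> the coordinates \<open>c 0, \<dots>, c (k - 1)\<close> are set aside as permanently
  free and only the remaining ones are shrunk. What step \<open>k\<close> achieves is therefore available in the
  limit cube only for points whose values on \<open>c ` {..<k}\<close> have been overwritten by those of the
  condition of that step. The numbers \<open>l k\<close> record auxiliary data of the steps, and \<open>b\<close> allows to
  demand that the free coordinates be large.
\<close>
lemma fusion: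
  fixes R :: "nat \<Rightarrow> nat set \<Rightarrow> nat set \<Rightarrow> (nat \<Rightarrow> nat) \<Rightarrow> nat \<Rightarrow> bool"
  assumes "infinite F" "z \<in> grid"
    and dense: "\<And>k S F' z' l. finite S \<Longrightarrow> S \<subseteq> F \<Longrightarrow> F' \<inter> S = {} \<Longrightarrow> subcube F z F' z' \<Longrightarrow>
       \<exists>F'' z'' l''. subcube F' z' F'' z'' \<and> l < l'' \<and> R k S F'' z'' l''"
  obtains c l w where "strict_mono c" "\<And>k. b k \<le> c k" "strict_mono l"
    "range c \<subseteq> F" "w \<in> cube F z"
    "\<And>k. \<exists>F' z'. R k (c ` {..<k}) F' z' (l k) \<and>
       (\<forall>x\<in>cube (range c) w. override_on x z' (c ` {..<k}) \<in> cube F' z')"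
proof -
  define P where "P = (\<lambda>k (S, F', z', l). (k = 0 \<longrightarrow> S = {}) \<and> finite S \<and> S \<subseteq> F \<and> F' \<inter> S = {} \<and>
    subcube F z F' z' \<and> R k S F' z' l)"
  define Q where "Q = (\<lambda>k (S, F', z', l) (S', F'', z'', l'). \<exists>c\<in>F'. b k \<le> c \<and> (\<forall>i\<in>S. i < c) \<and>
    S' = insert c S \<and> subcube (F' - {c}) z' F'' z'' \<and> l < (l'::nat))"
  have "\<exists>s. \<forall>n. P n (s n) \<and> Q n (s n) (s (Suc n))"
  proof (rule dependent_nat_choice)
    obtain F'' z'' l'' where "subcube F z F'' z''" "R 0 {} F'' z'' l''"
      using dense[of "{}" F z 0 0] subcube_refl[OF assms(1,2)] by auto
    then have "P 0 ({}, F'', z'', l'')" by (simp add: P_def)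
    then show "\<exists>s. P 0 s" by blast
  next
    fix s n assume P: "P n s"
    obtain S F' z' l where s: "s = (S, F', z', l)" using prod_cases4 by blast
    have *: "finite S" "S \<subseteq> F" "F' \<inter> S = {}" "subcube F z F' z'" using P by (auto simp: P_def s)
    have "infinite F'" using * subcubeD by blast
    then have "\<exists>c>Max (insert (b n) S). c \<in> F'" using infinite_nat_iff_unbounded by blast
    then obtain c where c: "c \<in> F'" "Max (insert (b n) S) < c" by blast
    have c': "b n \<le> c" "\<forall>i\<in>S. i < c" using c *(1) by auto
    have sub: "subcube F' z' (F' - {c}) z'" "subcube F z (F' - {c}) z'"
      using * subcubeD[OF *(4)] by (auto simp: subcube_def base_in_cube)
    have "\<exists>F'' z'' l''. subcube (F' - {c}) z' F'' z'' \<and> l < l'' \<and> R (Suc n) (insert c S) F'' z'' l''"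
      using * c sub subcubeD(2)[OF *(4)] by (intro dense) auto
    then obtain F'' z'' l'' where 2: "subcube (F' - {c}) z' F'' z''" "l < l''"
      "R (Suc n) (insert c S) F'' z'' l''" by blast
    have "P (Suc n) (insert c S, F'', z'', l'')"
      using * c 2 subcube_trans[OF sub(2) 2(1)] subcubeD(2)[OF 2(1)] subcubeD(2)[OF *(4)]
      by (auto simp: P_def)
    moreover have "Q n s (insert c S, F'', z'', l'')"
      unfolding Q_def s prod.case using c(1) c' 2 by (intro bexI[of _ c]) auto
    ultimately show "\<exists>y. P (Suc n) y \<and> Q n s y" by blast
  qed
  then obtain s where s: "\<And>n. P n (s n)" "\<And>n. Q n (s n) (s (Suc n))" by blast
  define S where "S k = fst (s k)" for k
  define G where "G k = fst (snd (s k))" for k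
  define y where "y k = fst (snd (snd (s k)))" for k
  define l where "l k = snd (snd (snd (s k)))" for k
  have s_eq: "s k = (S k, G k, y k, l k)" for k by (simp add: S_def G_def y_def l_def)
  have P: "finite (S k)" "S k \<subseteq> F" "G k \<inter> S k = {}" "subcube F z (G k) (y k)"
    "R k (S k) (G k) (y k) (l k)" for k
    using s(1)[of k] by (auto simp: P_def s_eq)
  have "\<exists>c. c\<in>G k \<and> b k \<le> c \<and> (\<forall>i\<in>S k. i < c) \<and> S (Suc k) = insert c (S k) \<and>
    subcube (G k - {c}) (y k) (G (Suc k)) (y (Suc k)) \<and> l k < l (Suc k)" for k
    using s(2)[of k] by (auto simp: Q_def s_eq)
  then obtain c where c: "\<And>k. c k \<in> G k" "\<And>k. b k \<le> c k" "\<And>k. \<forall>i\<in>S k. i < c k"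
    "\<And>k. S (Suc k) = insert (c k) (S k)"
    "\<And>k. subcube (G k - {c k}) (y k) (G (Suc k)) (y (Suc k))" "\<And>k. l k < l (Suc k)"
    by metis
  have S_eq: "S k = c ` {..<k}" for k
  proof (induction k)
    case 0
    show ?case using s(1)[of 0] by (simp add: P_def s_eq)
  next
    case (Suc k)
    then show ?case using c(4)[of k] by (simp add: lessThan_Suc)
  qed
  have "strict_mono c"
    unfolding strict_mono_def using c(3) S_eq by (metis image_eqI lessThan_iff)
  moreover have "strict_mono l" using c(6) by (simp add: strict_mono_Suc_iff)
  moreover have "range c \<subseteq> F" using c(1) P(4) subcubeD(2) by blast
  moreover
  have G_dec: "G k' \<subseteq> G k" if "k \<le> k'" for k k'
    using that by (induction rule: dec_induct) (use c(5) subcubeD(2) in blast)+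
  have y_stable: "y k' i = y k i" if "k \<le> k'" "i \<notin> G k" for k k' i
    using that
  proof (induction rule: dec_induct)
    case (step n)
    then have "i \<notin> G n" using G_dec by blast
    then show ?case using subcubeD(3)[OF c(5)[of n]] step by (auto simp: cube_def)
  qed simp
  \<comment> \<open>Every coordinate that is eventually frozen keeps the value it was frozen to.\<close>
  define w where "w i = (if \<exists>k. i \<notin> G k then y (LEAST k. i \<notin> G k) i else z i)" for i
  have w_eq: "w i = y k i" if "i \<notin> G k" for i k
  proof -
    have "i \<notin> G (LEAST k. i \<notin> G k)" "(LEAST k. i \<notin> G k) \<le> k"
      using that by (rule LeastI, rule Least_le)
    then show ?thesis using y_stable that unfolding w_def by auto
  qed
  have w: "w \<in> cube F z"
  proof -
    have "w i \<le> M i" for i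
      using subcubeD(4)[OF P(4)] assms(2) by (auto simp: w_def grid_def)
    moreover have "w i = z i" if "i \<notin> F" for i
      using w_eq[of i 0] subcubeD(2,3)[OF P(4)[of 0]] that by (auto simp: cube_def)
    ultimately show ?thesis by (auto simp: cube_def grid_def)
  qed
  have "\<exists>F' z'. R k (c ` {..<k}) F' z' (l k) \<and>
      (\<forall>x\<in>cube (range c) w. override_on x z' (c ` {..<k}) \<in> cube F' z')" for k
  proof (intro exI conjI ballI)
    show "R k (c ` {..<k}) (G k) (y k) (l k)" using P(5) by (simp add: S_eq)
    fix x assume x: "x \<in> cube (range c) w"
    have "x i = y k i" if i: "i \<notin> G k" "i \<notin> c ` {..<k}" for i
    proof -
      have "i \<noteq> c k'" for k'
      proof (cases "k' < k")
        case False
        then have "c k' \<in> G k" using c(1)[of k'] G_dec[of k k'] by auto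
        then show ?thesis using i by blast
      qed (use i in auto)
      then have "x i = w i" using x by (auto simp: cube_def)
      then show ?thesis using w_eq i by simp
    qed
    moreover have "y k \<in> grid" using P(4) subcubeD(4) by blast
    ultimately show "override_on x (y k) (c ` {..<k}) \<in> cube (G k) (y k)"
      using x by (auto simp: cube_def grid_def override_on_def)
  qed
  ultimately show thesis using that c(2) w by blast
qed

lemma homogeneous_eq_coordinate: "homogeneous {x. x c = v}"
  unfolding homogeneous_def
proof (intro allI impI)
  fix F :: "nat set" and z assume "infinite F" "z \<in> grid"
  then have "subcube F z (F - {c}) z" by (simp add: subcube_def base_in_cube)
  moreover have "\<forall>x \<in> cube (F - {c}) z. x c = z c" by (simp add: cube_def)
  ultimately show "\<exists>F' z'. subcube F z F' z' \<and>
      (cube F' z' \<subseteq> {x. x c = v} \<or> cube F' z' \<inter> {x. x c = v} = {})"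
    by (intro exI[of _ "F - {c}"] exI[of _ z]) (cases "z c = v"; auto)
qed

lemma homogeneous_Compl: "homogeneous B \<Longrightarrow> homogeneous (- B)"
  unfolding homogeneous_def disjoint_eq_subset_Compl double_compl by blast

lemma homogeneous_override:
  assumes "homogeneous B" "a \<in> grid" "finite S"
  shows "homogeneous {x. override_on x a S \<in> B}"
  unfolding homogeneous_def
proof (intro allI impI)
  fix F :: "nat set" and z assume F: "infinite F" "z \<in> grid"
  let ?B = "{x. override_on x a S \<in> B}"
  have "override_on z a S \<in> grid" using F assms by (auto simp: grid_def override_on_def)
  moreover have "infinite (F - S)" using F assms by auto
  ultimately obtain F' u where 1: "subcube (F - S) (override_on z a S) F' u"
    and 2: "cube F' u \<subseteq> B \<or> cube F' u \<inter> B = {}"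
    using assms(1) unfolding homogeneous_def by blast
  have u: "F' \<subseteq> F - S" "infinite F'" "u \<in> grid" "\<And>c. c \<notin> F - S \<Longrightarrow> u c = override_on z a S c"
    using subcubeD[OF 1] by (auto simp: cube_def)
  have "subcube F z F' (override_on u z S)"
    using u F by (auto simp: subcube_def cube_def grid_def override_on_def)
  moreover have "override_on x a S \<in> cube F' u" if "x \<in> cube F' (override_on u z S)" for x
    using that u assms(2) by (auto simp: cube_def grid_def override_on_def)
  then have "cube F' (override_on u z S) \<subseteq> ?B \<or> cube F' (override_on u z S) \<inter> ?B = {}"
    using 2 by blast
  ultimately show "\<exists>F' z'. subcube F z F' z' \<and> (cube F' z' \<subseteq> ?B \<or> cube F' z' \<inter> ?B = {})"
    by blast
qed

text \<open>
  Canonical representatives of the values on a finite set \<open>S\<close>: a finite set, because the values off \<open>S\<close>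
  are fixed to be 0.
\<close>
definition assignments :: "nat set \<Rightarrow> (nat \<Rightarrow> nat) set" where
  "assignments S = {a \<in> grid. \<forall>c. c \<notin> S \<longrightarrow> a c = 0}"

lemma finite_assignments:
  assumes "finite S"
  shows "finite (assignments S)"
proof -
  have "finite {a. \<forall>c. (c \<in> S \<longrightarrow> a c \<in> {..Max (M ` S)}) \<and> (c \<notin> S \<longrightarrow> a c = 0)}"
    using assms by (intro finite_set_of_finite_funs) auto
  moreover have "assignments S \<subseteq> {a. \<forall>c. (c \<in> S \<longrightarrow> a c \<in> {..Max (M ` S)}) \<and> (c \<notin> S \<longrightarrow> a c = 0)}"
    using assms by (auto simp: assignments_def grid_def intro: order_trans[OF _ Max_ge])
  ultimately show ?thesis by (rule finite_subset[rotated])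
qed

lemma obtain_assignment:
  assumes "a \<in> grid"
  obtains a' where "a' \<in> assignments S" "\<And>x. override_on x a S = override_on x a' S"
proof
  show "(\<lambda>c. if c \<in> S then a c else 0) \<in> assignments S"
    using assms by (auto simp: assignments_def grid_def)
qed (auto simp: override_on_def)

text \<open>
  If no subcube lies inside any \<open>B k\<close>, then homogeneity always yields the other alternative, and
  fusion avoids all the \<open>B k\<close> at once: in step \<open>k\<close> the set \<open>B k\<close> is avoided for each of the finitely many
  assignments to the coordinates set aside so far.
\<close>
lemma homogeneous_dichotomy:
  assumes hom: "\<And>k::nat. homogeneous (B k)" and F: "infinite F" "z \<in> grid"
  shows "(\<exists>k F' z'. subcube F z F' z' \<and> cube F' z' \<subseteq> B k) \<or>
         (\<exists>F' z'. subcube F z F' z' \<and> cube F' z' \<inter> (\<Union>k. B k) = {})"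
proof (cases "\<exists>k F' z'. subcube F z F' z' \<and> cube F' z' \<subseteq> B k")
  case none: False
  define R where "R k S F' z' (l::nat) \<longleftrightarrow>
    (\<forall>a\<in>assignments S. \<forall>x\<in>cube F' z'. override_on x a S \<notin> B k)" for k S F' z' l
  have dense: "\<exists>F'' z'' l''. subcube F' z' F'' z'' \<and> l < l'' \<and> R k S F'' z'' l''"
    if S: "finite S" "S \<subseteq> F" "F' \<inter> S = {}" "subcube F z F' z'" for k S F' z' l
  proof -
    have "\<exists>F'' z''. subcube F' z' F'' z'' \<and>
      (\<forall>a\<in>assignments S. \<forall>x\<in>cube F'' z''. override_on x a S \<notin> B k)"
    proof (rule subcube_finite_conj)
      show "finite (assignments S)" by (rule finite_assignments[OF S(1)])
      show "infinite F'" "z' \<in> grid" using subcubeD[OF S(4)] by auto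
      fix a G y assume a: "a \<in> assignments S" and sub: "subcube F' z' G y"
      have ag: "a \<in> grid" using a by (simp add: assignments_def)
      obtain G' y' where 1: "subcube G y G' y'"
        and 2: "cube G' y' \<subseteq> {x. override_on x a S \<in> B k} \<or>
          cube G' y' \<inter> {x. override_on x a S \<in> B k} = {}"
        using homogeneous_override[OF hom[of k] ag S(1)] subcubeD[OF sub]
        unfolding homogeneous_def by meson
      have G': "subcube F z G' y'" "subcube F' z' G' y'" using 1 sub S(4) subcube_trans by blast+
      have "cube G' y' \<inter> {x. override_on x a S \<in> B k} = {}"
      proof (rule ccontr)
        assume "\<not> ?thesis"
        then have sub_B: "cube G' y' \<subseteq> {x. override_on x a S \<in> B k}" using 2 by blast
        have "subcube F z G' (override_on y' a S)"
          using subcubeD[OF G'(1)] S(2) ag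
          by (auto simp: subcube_def cube_def grid_def override_on_def)
        moreover have "cube G' (override_on y' a S) \<subseteq> B k"
        proof
          fix x assume x: "x \<in> cube G' (override_on y' a S)"
          have disj: "G' \<inter> S = {}" using subcubeD(2)[OF G'(2)] S(3) by blast
          have "override_on x y' S \<in> cube G' y'"
            using x subcubeD(4)[OF G'(1)] by (auto simp: cube_def grid_def override_on_def)
          then have "override_on (override_on x y' S) a S \<in> B k" using sub_B by blast
          also have "override_on (override_on x y' S) a S = x"
            using x disj by (auto simp: cube_def override_on_def fun_eq_iff)
          finally show "x \<in> B k" .
        qed
        ultimately show False using none by blast
      qed
      then show "\<exists>F'' z''. subcube G y F'' z'' \<and> (\<forall>x\<in>cube F'' z''. override_on x a S \<notin> B k)"
        using 1 by blast
    qed blast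
    then show ?thesis unfolding R_def by blast
  qed
  obtain c l w where clw: "strict_mono c" "range c \<subseteq> F" "w \<in> cube F z"
    "\<And>k. \<exists>F' z'. R k (c ` {..<k}) F' z' (l k) \<and>
       (\<forall>x\<in>cube (range c) w. override_on x z' (c ` {..<k}) \<in> cube F' z')"
    by (rule fusion[of F z R "\<lambda>_. 0", OF F dense]) blast+
  have "subcube F z (range c) w"
    using clw by (auto simp: subcube_def range_inj_infinite strict_mono_imp_inj_on)
  moreover have "x \<notin> B k" if x: "x \<in> cube (range c) w" for x k
  proof -
    let ?S = "c ` {..<k}"
    obtain F' z' where *: "R k ?S F' z' (l k)" "override_on x z' ?S \<in> cube F' z'"
      using clw(4) x by blast
    have "x \<in> grid" using x by (simp add: cube_def)
    then obtain a where a: "a \<in> assignments ?S"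
      "\<And>y. override_on y x ?S = override_on y a ?S"
      by (rule obtain_assignment) blast
    have "override_on (override_on x z' ?S) x ?S \<notin> B k" using * a unfolding R_def by metis
    moreover have "override_on (override_on x z' ?S) x ?S = x" by (auto simp: override_on_def)
    ultimately show ?thesis by simp
  qed
  ultimately show ?thesis by blast
qed blast

lemma homogeneous_cover:
  assumes "\<And>k::nat. homogeneous (B k)" "infinite F" "z \<in> grid" "cube F z \<subseteq> (\<Union>k. B k)"
  shows "\<exists>k F' z'. subcube F z F' z' \<and> cube F' z' \<subseteq> B k"
proof (rule ccontr)
  assume "\<not> ?thesis"
  then obtain F' z' where 1: "subcube F z F' z'" "cube F' z' \<inter> (\<Union>k. B k) = {}"
    using homogeneous_dichotomy[of B, OF assms(1-3)] by blast
  have "z' \<in> cube F' z'" using subcubeD(4)[OF 1(1)] by (rule base_in_cube)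
  then show False using 1 assms(4) cube_mono[OF 1(1)] by blast
qed

definition homogeneous_algebra :: "(nat \<Rightarrow> nat) measure" where
  "homogeneous_algebra = sigma UNIV {B. homogeneous B}"

lemma space_homogeneous_algebra [simp]: "space homogeneous_algebra = UNIV"
  by (simp add: homogeneous_algebra_def)

lemma sets_homogeneous_algebra: "sets homogeneous_algebra = {B. homogeneous B}"
proof -
  have "sigma_algebra UNIV {B. homogeneous B}"
    unfolding sigma_algebra_iff2
  proof (intro conjI ballI allI impI)
    show "{} \<in> {B. homogeneous B}" using subcube_refl by (fastforce simp: homogeneous_def)
  next
    fix B assume "B \<in> {B. homogeneous B}"
    then show "UNIV - B \<in> {B. homogeneous B}"
      using homogeneous_Compl by (simp add: Compl_eq_Diff_UNIV)
  next
    fix B :: "nat \<Rightarrow> _" assume "range B \<subseteq> {B. homogeneous B}"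
    then have hom: "homogeneous (B k)" for k by auto
    have "homogeneous (\<Union>k. B k)"
      unfolding homogeneous_def
    proof (intro allI impI)
      fix F :: "nat set" and z assume "infinite F" "z \<in> grid"
      then consider k F' z' where "subcube F z F' z'" "cube F' z' \<subseteq> B k"
        | F' z' where "subcube F z F' z'" "cube F' z' \<inter> (\<Union>k. B k) = {}"
        using homogeneous_dichotomy[of B F z] hom by blast
      then show "\<exists>F' z'. subcube F z F' z' \<and>
          (cube F' z' \<subseteq> (\<Union>k. B k) \<or> cube F' z' \<inter> (\<Union>k. B k) = {})"
        by cases blast+
    qed
    then show "\<Union> (range B) \<in> {B. homogeneous B}" by simp
  qed simp
  then show ?thesis by (simp add: homogeneous_algebra_def sigma_algebra.sigma_sets_eq)
qed

lemma measurable_coordinate: "(\<lambda>x. x c) \<in> homogeneous_algebra \<rightarrow>\<^sub>M count_space UNIV"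
  using homogeneous_eq_coordinate
  by (subst measurable_count_space_eq_countable)
     (auto simp: sets_homogeneous_algebra vimage_def)

lemma measurable_override:
  assumes "a \<in> grid" "finite S"
  shows "(\<lambda>x. override_on x a S) \<in> homogeneous_algebra \<rightarrow>\<^sub>M homogeneous_algebra"
  using homogeneous_override[OF _ assms]
  by (intro measurableI) (auto simp: sets_homogeneous_algebra vimage_def)

text \<open>The level sets of \<open>\<lfloor>\<phi> / \<eta>\<rfloor>\<close> form a countable cover by homogeneous sets.\<close>
lemma subcube_small_oscillation:
  assumes "infinite F" "z \<in> grid" "\<phi> \<in> borel_measurable homogeneous_algebra" "(\<eta>::real) > 0"
  shows "\<exists>F' z'. subcube F z F' z' \<and> (\<forall>x\<in>cube F' z'. \<forall>y\<in>cube F' z'. \<bar>\<phi> x - \<phi> y\<bar> < \<eta>)"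
proof -
  define B where "B k = {x. \<lfloor>\<phi> x / \<eta>\<rfloor> = int_decode k}" for k
  have "{x \<in> space homogeneous_algebra. \<lfloor>\<phi> x / \<eta>\<rfloor> = int_decode k} \<in> sets homogeneous_algebra" for k
    using assms(3) by measurable
  then have hom: "homogeneous (B k)" for k by (simp add: sets_homogeneous_algebra B_def)
  have "x \<in> (\<Union>k. B k)" for x
    unfolding B_def by (auto intro!: exI[of _ "int_encode \<lfloor>\<phi> x / \<eta>\<rfloor>"])
  then obtain k F' z' where 1: "subcube F z F' z'" "cube F' z' \<subseteq> B k"
    using homogeneous_cover[of B, OF hom assms(1,2)] by blast
  have "\<bar>\<phi> x - \<phi> y\<bar> < \<eta>" if "x \<in> B k" "y \<in> B k" for x y
  proof -
    have "\<lfloor>\<phi> x / \<eta>\<rfloor> = \<lfloor>\<phi> y / \<eta>\<rfloor>" using that by (simp add: B_def)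
    then have "\<bar>\<phi> x / \<eta> - \<phi> y / \<eta>\<bar> < 1" by linarith
    then show ?thesis using assms(4) by (simp add: diff_divide_distrib[symmetric] abs_divide)
  qed
  then show ?thesis using 1 by blast
qed

end

section \<open>Windows of the output controlled by single coordinates\<close>

context finite_product
begin

text \<open>
  In step \<open>k\<close> of the fusion two things are arranged. First, changing the coordinates set aside so
  far has little effect beyond the position \<open>l k\<close>: for every point such a position exists because
  finitely many changes give summable differences, and \<open>homogeneous_cover\<close> makes it uniform. Secondly,
  the first \<open>l k\<close> outputs hardly depend on the coordinates that are still to be chosen: finitely many
  real functions are given small oscillation by shrinking. The order matters, since the oscillation
  is bounded only after \<open>l k\<close> is known. On the window from \<open>l k\<close> to \<open>l (Suc k)\<close> the output is then
  determined by the coordinate \<open>c k\<close> up to a small error.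
\<close>
lemma block_decomposition:
  fixes \<Theta> :: "(nat \<Rightarrow> nat) \<Rightarrow> nat \<Rightarrow> real" and g :: "real \<Rightarrow> real" and \<epsilon> :: "nat \<Rightarrow> real"
    and b :: "nat \<Rightarrow> nat"
  assumes meas: "\<And>j. (\<lambda>x. \<Theta> x j) \<in> borel_measurable homogeneous_algebra"
    and unit: "\<And>x j. \<Theta> x j \<in> {0..1}"
    and g: "continuous_on {0..1} g" "g 0 = 0"
    and fin: "\<And>x y. x \<in> grid \<Longrightarrow> y \<in> grid \<Longrightarrow> finite {c. x c \<noteq> y c} \<Longrightarrow>
                summable (\<lambda>j. g \<bar>\<Theta> x j - \<Theta> y j\<bar>)"
    and \<epsilon>: "\<And>k. 0 < \<epsilon> k"
  obtains c l w where "strict_mono c" "\<And>k. b k \<le> c k" "strict_mono l" "w \<in> grid"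
    "\<And>k x y n. x \<in> cube (range c) w \<Longrightarrow> y \<in> cube (range c) w \<Longrightarrow> (\<And>i. k \<le> i \<Longrightarrow> x (c i) = y (c i)) \<Longrightarrow>
       (\<Sum>j\<in>{l k..<n}. g \<bar>\<Theta> x j - \<Theta> y j\<bar>) \<le> \<epsilon> k"
    "\<And>k x y. x \<in> cube (range c) w \<Longrightarrow> y \<in> cube (range c) w \<Longrightarrow> (\<And>i. i < k \<Longrightarrow> x (c i) = y (c i)) \<Longrightarrow>
       (\<Sum>j<l k. g \<bar>\<Theta> x j - \<Theta> y j\<bar>) \<le> \<epsilon> k"
proof -
  let ?d = "\<lambda>x y j. g \<bar>\<Theta> x j - \<Theta> y j\<bar>"
  let ?o = "\<lambda>x a S. override_on x a S"
  have g_meas: "(\<lambda>t. g (max 0 (min 1 t))) \<in> borel_measurable borel"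
    by (intro borel_measurable_continuous_onI continuous_on_compose2[OF g(1)] continuous_intros) auto
  have d_meas: "(\<lambda>x. ?d (?o x a S) (?o x a' S) j) \<in> borel_measurable homogeneous_algebra"
    if "finite S" "a \<in> grid" "a' \<in> grid" for a a' S j
  proof -
    have "(\<lambda>x. \<Theta> (?o x a S) j) \<in> borel_measurable homogeneous_algebra"
      "(\<lambda>x. \<Theta> (?o x a' S) j) \<in> borel_measurable homogeneous_algebra"
      using that by (auto intro: measurable_compose[OF measurable_override meas])
    then have "(\<lambda>x. g (max 0 (min 1 \<bar>\<Theta> (?o x a S) j - \<Theta> (?o x a' S) j\<bar>))) \<in> borel_measurable homogeneous_algebra"
      by (intro measurable_compose[OF _ g_meas]) auto
    moreover have "max 0 (min 1 \<bar>\<Theta> x j - \<Theta> y j\<bar>) = \<bar>\<Theta> x j - \<Theta> y j\<bar>" for x y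
      using unit[of x j] unit[of y j] by auto
    ultimately show ?thesis by simp
  qed
  define tail where "tail k S l x \<longleftrightarrow> (\<forall>a\<in>assignments S. \<forall>a'\<in>assignments S. \<forall>n.
    (\<Sum>j\<in>{l..<n}. ?d (?o x a S) (?o x a' S) j) \<le> \<epsilon> k)" for k S l x
  define head where "head k S l X \<longleftrightarrow> (\<forall>a\<in>assignments S. \<forall>x\<in>X. \<forall>y\<in>X.
    (\<Sum>j<l. ?d (?o x a S) (?o y a S) j) \<le> \<epsilon> k)" for k S l X
  define R where "R k S F z l \<longleftrightarrow> (\<forall>x\<in>cube F z. tail k S l x) \<and> head k S l (cube F z)" for k S F z l
  have assignments_grid: "a \<in> grid" if "a \<in> assignments S" for a S
    using that by (simp add: assignments_def)
  have dense: "\<exists>F'' z'' l''. subcube F' z' F'' z'' \<and> l < l'' \<and> R k S F'' z'' l''"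
    if S: "finite S" "subcube UNIV (\<lambda>_. 0) F' z'" for k S F' z' l
  proof -
    have F': "infinite F'" "z' \<in> grid" using subcubeD[OF S(2)] by auto
    have fin_A: "finite (assignments S)" using S(1) by (rule finite_assignments)
    have hom: "homogeneous {x. tail k S (Suc l + i) x}" for i
    proof -
      have "{x \<in> space homogeneous_algebra. tail k S (Suc l + i) x} \<in> sets homogeneous_algebra"
        unfolding tail_def using d_meas[OF S(1)] assignments_grid fin_A
        by (intro sets.sets_Collect_finite_All sets.sets_Collect_countable_All
            borel_measurable_le borel_measurable_sum borel_measurable_const) auto
      then show ?thesis by (simp add: sets_homogeneous_algebra)
    qed
    have "\<exists>i. tail k S (Suc l + i) x" if x: "x \<in> cube F' z'" for x
    proof -
      have "\<forall>\<^sub>F i in sequentially. \<forall>n. (\<Sum>j\<in>{i..<n}. ?d (?o x a S) (?o x a' S) j) \<le> \<epsilon> k"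
        if "a \<in> assignments S" "a' \<in> assignments S" for a a'
      proof -
        have "summable (?d (?o x a S) (?o x a' S))"
        proof (rule fin)
          show "?o x a S \<in> grid" "?o x a' S \<in> grid"
            using x that by (auto simp: cube_def grid_def assignments_def override_on_def)
          show "finite {c. ?o x a S c \<noteq> ?o x a' S c}"
            by (rule finite_subset[OF _ S(1)]) (auto simp: override_on_def)
        qed
        then obtain N where "\<And>m n. m \<ge> N \<Longrightarrow> norm (\<Sum>j\<in>{m..<n}. ?d (?o x a S) (?o x a' S) j) < \<epsilon> k"
          using \<epsilon>[of k] unfolding summable_Cauchy by blast
        then show ?thesis unfolding eventually_sequentially by (intro exI[of _ N]) (auto simp: abs_less_iff less_imp_le)
      qed
      then have "\<forall>\<^sub>F i in sequentially. tail k S i x"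
        unfolding tail_def using fin_A by (intro eventually_ball_finite ballI) auto
      then show ?thesis
        unfolding eventually_sequentially by (metis le_add2)
    qed
    then obtain i F1 z1 where 1: "subcube F' z' F1 z1" "cube F1 z1 \<subseteq> {x. tail k S (Suc l + i) x}"
      using homogeneous_cover[of "\<lambda>i. {x. tail k S (Suc l + i) x}", OF hom F'] by blast
    let ?l = "Suc l + i"
    obtain \<eta> where \<eta>: "\<eta> > 0" "\<And>t. t \<in> {0..1} \<Longrightarrow> t < \<eta> \<Longrightarrow> g t \<le> \<epsilon> k / ?l"
    proof -
      have "\<epsilon> k / ?l > 0" using \<epsilon>[of k] by simp
      then obtain \<eta> where \<eta>: "\<eta> > 0" "\<forall>t\<in>{0..1}. dist t 0 < \<eta> \<longrightarrow> dist (g t) (g 0) < \<epsilon> k / ?l"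
        using g(1)[unfolded continuous_on_iff, rule_format, of 0 "\<epsilon> k / ?l"] by auto
      have "g t \<le> \<epsilon> k / ?l" if "t \<in> {0..1}" "t < \<eta>" for t
      proof -
        have "dist t 0 < \<eta>" using that by (simp add: dist_real_def)
        then have "dist (g t) (g 0) < \<epsilon> k / ?l" using \<eta>(2) that(1) by blast
        then show ?thesis unfolding dist_real_def g(2) by linarith
      qed
      then show thesis using that \<eta>(1) by blast
    qed
    have "\<exists>F2 z2. subcube F1 z1 F2 z2 \<and> (\<forall>p\<in>{..<?l} \<times> assignments S. \<forall>x\<in>cube F2 z2. \<forall>y\<in>cube F2 z2.
        \<bar>\<Theta> (?o x (snd p) S) (fst p) - \<Theta> (?o y (snd p) S) (fst p)\<bar> < \<eta>)"
    proof (rule subcube_finite_conj)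
      show "finite ({..<?l} \<times> assignments S)" using fin_A by simp
      show "infinite F1" "z1 \<in> grid" using subcubeD[OF 1(1)] by auto
      fix p F3 z3 assume p: "p \<in> {..<?l} \<times> assignments S" and sub: "subcube F1 z1 F3 z3"
      have "(\<lambda>x. \<Theta> (?o x (snd p) S) (fst p)) \<in> borel_measurable homogeneous_algebra"
        using p assignments_grid S(1) by (intro measurable_compose[OF measurable_override meas]) auto
      then show "\<exists>F'' z''. subcube F3 z3 F'' z'' \<and> (\<forall>x\<in>cube F'' z''. \<forall>y\<in>cube F'' z''.
          \<bar>\<Theta> (?o x (snd p) S) (fst p) - \<Theta> (?o y (snd p) S) (fst p)\<bar> < \<eta>)"
        by (rule subcube_small_oscillation[OF subcubeD(1)[OF sub] subcubeD(4)[OF sub] _ \<eta>(1)])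
    qed blast
    then obtain F2 z2 where 2: "subcube F1 z1 F2 z2" "\<And>j a x y. j < ?l \<Longrightarrow> a \<in> assignments S \<Longrightarrow>
        x \<in> cube F2 z2 \<Longrightarrow> y \<in> cube F2 z2 \<Longrightarrow> \<bar>\<Theta> (?o x a S) j - \<Theta> (?o y a S) j\<bar> < \<eta>"
      by force
    have "head k S ?l (cube F2 z2)"
      unfolding head_def
    proof (intro ballI)
      fix a x y assume "a \<in> assignments S" "x \<in> cube F2 z2" "y \<in> cube F2 z2"
      then have "?d (?o x a S) (?o y a S) j \<le> \<epsilon> k / ?l" if "j < ?l" for j
        using 2(2) that unit by (intro \<eta>(2) dist_unit) auto
      then have "(\<Sum>j<?l. ?d (?o x a S) (?o y a S) j) \<le> (\<Sum>j<?l. \<epsilon> k / ?l)"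
        by (intro sum_mono) auto
      then show "(\<Sum>j<?l. ?d (?o x a S) (?o y a S) j) \<le> \<epsilon> k" by simp
    qed
    moreover have "\<forall>x\<in>cube F2 z2. tail k S ?l x" using 1(2) cube_mono[OF 2(1)] by blast
    moreover have "subcube F' z' F2 z2" using 1(1) 2(1) by (rule subcube_trans)
    ultimately show ?thesis unfolding R_def by (intro exI[of _ F2] exI[of _ z2] exI[of _ ?l]) auto
  qed
  obtain c l w where clw: "strict_mono c" "\<And>k. b k \<le> c k" "strict_mono l" "w \<in> cube UNIV (\<lambda>_. 0)"
    and R: "\<And>k. \<exists>F' z'. R k (c ` {..<k}) F' z' (l k) \<and>
       (\<forall>x\<in>cube (range c) w. ?o x z' (c ` {..<k}) \<in> cube F' z')"
    by (rule fusion[of UNIV "\<lambda>_. 0" R b]) (use dense in \<open>auto simp: grid_def\<close>)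
  show thesis
  proof (rule that[OF clw(1-3)])
    show "w \<in> grid" using clw(4) cube_subset_grid by blast
    fix k x y assume xy: "x \<in> cube (range c) w" "y \<in> cube (range c) w"
    let ?S = "c ` {..<k}"
    obtain F z where Rk: "R k ?S F z (l k)" and in_cube: "\<And>x. x \<in> cube (range c) w \<Longrightarrow> ?o x z ?S \<in> cube F z"
      using R by blast
    have "x \<in> grid" "y \<in> grid" using xy cube_subset_grid by blast+
    then obtain a a' where a: "a \<in> assignments ?S" "\<And>u. ?o u x ?S = ?o u a ?S"
      and a': "a' \<in> assignments ?S" "\<And>u. ?o u y ?S = ?o u a' ?S"
      using obtain_assignment by metis
    have restore: "?o (?o x z ?S) a ?S = x" "?o (?o y z ?S) a' ?S = y"
      using a(2)[symmetric] a'(2)[symmetric] by (auto simp: override_on_def)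
    {
      fix n assume agree: "\<And>i. k \<le> i \<Longrightarrow> x (c i) = y (c i)"
      have "?o x z ?S = ?o y z ?S"
      proof
        fix i
        show "?o x z ?S i = ?o y z ?S i"
        proof (cases "i \<in> range c")
          case True
          then obtain j where j: "i = c j" by blast
          then show ?thesis using agree[of j] by (cases "j < k") (auto simp: override_on_def)
        next
          case False
          then show ?thesis using xy by (auto simp: cube_def override_on_def)
        qed
      qed
      then have "?o (?o x z ?S) a' ?S = y" using restore(2) by simp
      moreover have "tail k ?S (l k) (?o x z ?S)" using Rk in_cube[OF xy(1)] by (simp add: R_def)
      then have "(\<Sum>j\<in>{l k..<n}. ?d (?o (?o x z ?S) a ?S) (?o (?o x z ?S) a' ?S) j) \<le> \<epsilon> k"
        unfolding tail_def using a(1) a'(1) by blast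
      ultimately show "(\<Sum>j\<in>{l k..<n}. ?d x y j) \<le> \<epsilon> k" using restore(1) by simp
    next
      assume agree: "\<And>i. i < k \<Longrightarrow> x (c i) = y (c i)"
      have "?o (?o y z ?S) x ?S = y"
        using agree by (auto simp: override_on_def fun_eq_iff)
      then have "?o (?o y z ?S) a ?S = y" using a(2) by simp
      moreover have "head k ?S (l k) (cube F z)" using Rk by (simp add: R_def)
      then have "(\<Sum>j<l k. ?d (?o (?o x z ?S) a ?S) (?o (?o y z ?S) a ?S) j) \<le> \<epsilon> k"
        unfolding head_def using a(1) in_cube[OF xy(1)] in_cube[OF xy(2)] by blast
      ultimately show "(\<Sum>j<l k. ?d x y j) \<le> \<epsilon> k" using restore(1) by simp
    }
  qed
qed

end

section \<open>Non-reducibility\<close>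

lemma summable_blocks_iff:
  fixes a :: "nat \<Rightarrow> real"
  assumes "strict_mono l" and nonneg: "\<And>j. 0 \<le> a j"
  shows "summable (\<lambda>k. \<Sum>j\<in>{l k..<l (Suc k)}. a j) \<longleftrightarrow> summable a"
proof -
  let ?b = "\<lambda>k. \<Sum>j\<in>{l k..<l (Suc k)}. a j"
  have partial: "(\<Sum>j<l n. a j) = (\<Sum>j<l 0. a j) + (\<Sum>k<n. ?b k)" for n
  proof (induction n)
    case (Suc n)
    have "l n \<le> l (Suc n)" using assms(1) by (simp add: strict_mono_less_eq)
    then have "{..<l (Suc n)} = {..<l n} \<union> {l n..<l (Suc n)}" by auto
    then have "(\<Sum>j<l (Suc n). a j) = (\<Sum>j<l n. a j) + ?b n"
      by (simp add: sum.union_disjoint disjoint_iff)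
    then show ?case using Suc by simp
  qed simp
  have b_nonneg: "0 \<le> ?b k" for k using nonneg by (simp add: sum_nonneg)
  show ?thesis
  proof
    assume b: "summable ?b"
    show "summable a"
    proof (rule summableI_nonneg_bounded)
      fix n
      have "(\<Sum>j<n. a j) \<le> (\<Sum>j<l n. a j)"
        using nonneg strict_mono_imp_increasing[OF assms(1), of n] by (intro sum_mono2) auto
      also have "\<dots> \<le> (\<Sum>j<l 0. a j) + suminf ?b"
        unfolding partial[of n] using b b_nonneg by (intro add_left_mono sum_le_suminf) auto
      finally show "(\<Sum>j<n. a j) \<le> (\<Sum>j<l 0. a j) + suminf ?b" .
    qed (rule nonneg)
  next
    assume a: "summable a"
    show "summable ?b"
    proof (rule summableI_nonneg_bounded)
      fix n
      have "(\<Sum>k<n. ?b k) \<le> (\<Sum>j<l n. a j)" unfolding partial[of n] using nonneg by (simp add: sum_nonneg)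
      also have "\<dots> \<le> suminf a" using a nonneg by (intro sum_le_suminf) auto
      finally show "(\<Sum>k<n. ?b k) \<le> suminf a" .
    qed (rule b_nonneg)
  qed
qed

text \<open>
  By convexity the average of the step values is at least \<open>g\<close> of the average step, which is at
  least \<open>g (\<bar>t 0 - t m\<bar> / m)\<close>; supermultiplicativity splits off the factor \<open>g (1 / m)\<close>.
\<close>
lemma (in gauge) path_estimate:
  assumes t: "\<And>i. t i \<in> {0..1}" and m: "0 < m"
  shows "g (1 / real m) * g \<bar>t 0 - t m\<bar> \<le> (\<Sum>i<m. g \<bar>t i - t (Suc i)\<bar>) / real m"
proof -
  let ?d = "\<lambda>i. \<bar>t i - t (Suc i)\<bar>"
  have d: "?d i \<in> {0..1}" for i using t by (intro dist_unit)
  have "\<bar>t 0 - t m\<bar> = \<bar>\<Sum>i<m. t i - t (Suc i)\<bar>" by (simp add: sum_lessThan_telescope')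
  also have "\<dots> \<le> (\<Sum>i<m. ?d i)" by (rule sum_abs)
  finally have le: "1 / real m * \<bar>t 0 - t m\<bar> \<le> (\<Sum>i<m. ?d i) / m"
    by (simp add: divide_right_mono)
  have "(\<Sum>i<m. ?d i) \<le> (\<Sum>i<m. 1)" using d by (intro sum_mono) auto
  then have avg: "(\<Sum>i<m. ?d i) / m \<le> 1" using m by simp
  have "g (1 / real m) * g \<bar>t 0 - t m\<bar> \<le> g (1 / real m * \<bar>t 0 - t m\<bar>)"
    using m dist_unit[OF t t] by (intro supermult) auto
  also have "\<dots> \<le> g ((\<Sum>i<m. ?d i) / m)" using le avg m by (intro mono) auto
  also have "(\<Sum>i<m. ?d i) / m = (\<Sum>i<m. (1 / real m) *\<^sub>R ?d i)" by (simp add: sum_divide_distrib)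
  also have "g \<dots> \<le> (\<Sum>i<m. (1 / real m) * g (?d i))"
    using m d by (intro convex_on_sum[OF _ _ convex]) auto
  also have "\<dots> = (\<Sum>i<m. g (?d i)) / m" by (simp add: sum_divide_distrib)
  finally show ?thesis .
qed

text \<open>
  For a reduction \<open>\<theta>\<close>, decompose its restriction to a product of grids into windows, the \<open>k\<close>-th free
  grid \<open>{i / 2 ^ c k | i \<le> 2 ^ c k}\<close> containing the multiples of \<open>1 / 2 ^ s k\<close>. Let \<open>D k\<close> be the
  \<open>g\<close>-distance in the \<open>k\<close>-th window. Equivalence modulo \<open>E_rel f\<close> of two points of the product then
  amounts to summability of \<open>D k\<close> over their coordinates (\<open>D_iff\<close> in the proof). It is used twice:
  moving each coordinate by one suitable step of length \<open>1 / 2 ^ s k\<close> shows that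
  \<open>g (1 / 2 ^ s k) * D k 0 (2 ^ c k)\<close> is summable, and moving infinitely many coordinates all the way
  from 0 to 1 gives the contradiction.
\<close>
theorem (in gauge) not_reducible:
  fixes f :: "real \<Rightarrow> real" and s :: "nat \<Rightarrow> nat"
  assumes f: "f 0 = 0" "0 < f 1"
    and summ_f: "summable (\<lambda>k. f (1 / 2 ^ s k))"
    and not_summ_g: "\<not> summable (\<lambda>k. g (1 / 2 ^ s k))"
  shows "\<not> borel_reducible unit_sequences (E_rel f) unit_sequences (E_rel g)"
proof
  assume "borel_reducible unit_sequences (E_rel f) unit_sequences (E_rel g)"
  then obtain \<theta> where \<theta>: "\<theta> \<in> restrict_space borel unit_sequences \<rightarrow>\<^sub>M restrict_space borel unit_sequences"
    and red: "\<And>x x'. x \<in> unit_sequences \<Longrightarrow> x' \<in> unit_sequences \<Longrightarrow>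
      (x, x') \<in> E_rel f \<longleftrightarrow> (\<theta> x, \<theta> x') \<in> E_rel g"
    unfolding borel_reducible_def by blast
  interpret finite_product "\<lambda>c. 2 ^ c" .
  define e :: "(nat \<Rightarrow> nat) \<Rightarrow> nat \<Rightarrow> real" where "e x c = real (min (x c) (2 ^ c)) / 2 ^ c" for x c
  define \<Theta> where "\<Theta> x = \<theta> (e x)" for x
  have e_unit: "e x \<in> unit_sequences" for x
  proof -
    have "real (min (x c) (2 ^ c)) \<le> real (2 ^ c)" for c by (intro of_nat_mono) simp
    then show ?thesis by (auto simp: e_def unit_sequences_def)
  qed
  have \<theta>_unit: "\<theta> x \<in> unit_sequences" if "x \<in> unit_sequences" for x
    using measurable_space[OF \<theta>, of x] that by (simp add: space_restrict_space)
  have \<Theta>_unit: "\<Theta> x j \<in> {0..1}" for x j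
    unfolding \<Theta>_def by (intro unit_seqD \<theta>_unit e_unit)
  have \<Theta>_meas: "(\<lambda>x. \<Theta> x j) \<in> borel_measurable homogeneous_algebra" for j
  proof -
    have "(\<lambda>x. e x c) \<in> borel_measurable homogeneous_algebra" for c
      unfolding e_def by (rule measurable_compose[OF measurable_coordinate]) simp
    then have "e \<in> homogeneous_algebra \<rightarrow>\<^sub>M restrict_space borel unit_sequences"
      using e_unit by (intro measurable_restrict_space2 measurable_coordinatewise_then_product) auto
    from measurable_compose[OF this \<theta>] show ?thesis
      unfolding \<Theta>_def by (rule measurable_compose) (intro measurable_restrict_space1 measurable_coordinate_real)
  qed
  have related_iff: "summable (\<lambda>c. f \<bar>e x c - e y c\<bar>) \<longleftrightarrow> summable (\<lambda>j. g \<bar>\<Theta> x j - \<Theta> y j\<bar>)" for x y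
    using red[OF e_unit e_unit, of x y] e_unit \<theta>_unit
    by (simp add: E_rel_def \<Theta>_def abs_minus_commute)
  have fin: "summable (\<lambda>j. g \<bar>\<Theta> x j - \<Theta> y j\<bar>)" if "finite {c. x c \<noteq> y c}" for x y
    unfolding related_iff[symmetric]
    by (rule summable_finite[OF that]) (auto simp: e_def f)
  obtain c l w where c: "strict_mono c" "\<And>k. s k \<le> c k" and l: "strict_mono l" and w: "w \<in> grid"
    and tail: "\<And>k x y n. x \<in> cube (range c) w \<Longrightarrow> y \<in> cube (range c) w \<Longrightarrow> (\<And>i. k \<le> i \<Longrightarrow> x (c i) = y (c i)) \<Longrightarrow>
       (\<Sum>j\<in>{l k..<n}. g \<bar>\<Theta> x j - \<Theta> y j\<bar>) \<le> (1/2) ^ k"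
    and head: "\<And>k x y. x \<in> cube (range c) w \<Longrightarrow> y \<in> cube (range c) w \<Longrightarrow> (\<And>i. i < k \<Longrightarrow> x (c i) = y (c i)) \<Longrightarrow>
       (\<Sum>j<l k. g \<bar>\<Theta> x j - \<Theta> y j\<bar>) \<le> (1/2) ^ k"
    by (rule block_decomposition[of \<Theta> g "\<lambda>k. (1/2) ^ k" s])
       (use \<Theta>_meas \<Theta>_unit cont zero fin in auto)
  define X where "X v n = (if n \<in> range c then v (inv c n) else w n)" for v :: "nat \<Rightarrow> nat" and n
  have X_c [simp]: "X v (c k) = v k" for v k
    using strict_mono_imp_inj_on[OF c(1)] by (simp add: X_def)
  define good where "good v \<longleftrightarrow> (\<forall>k. v k \<le> 2 ^ c k)" for v :: "nat \<Rightarrow> nat"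
  have X_cube: "X v \<in> cube (range c) w" if "good v" for v
  proof -
    have "X v n \<le> 2 ^ n" for n
    proof (cases "n \<in> range c")
      case True
      then obtain k where "n = c k" by blast
      then show ?thesis using that by (simp add: good_def)
    next
      case False
      then show ?thesis using w by (simp add: grid_def X_def)
    qed
    then show ?thesis by (auto simp: cube_def grid_def X_def)
  qed
  define G where "G v v' j = g \<bar>\<Theta> (X v) j - \<Theta> (X v') j\<bar>" for v v' j
  have G_nonneg: "0 \<le> G v v' j" for v v' j unfolding G_def by (intro nonneg dist_unit \<Theta>_unit)
  have G_iff: "summable (\<lambda>k. f (\<bar>real (v k) - real (v' k)\<bar> / 2 ^ c k)) \<longleftrightarrow> summable (G v v')"
    if "good v" "good v'" for v v'
  proof -
    have "f \<bar>e (X v) (c k) - e (X v') (c k)\<bar> = f (\<bar>real (v k) - real (v' k)\<bar> / 2 ^ c k)" for k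
      using that by (simp add: e_def good_def diff_divide_distrib[symmetric] abs_divide)
    moreover have "f \<bar>e (X v) n - e (X v') n\<bar> = 0" if "n \<notin> range c" for n
      using that f by (simp add: e_def X_def)
    ultimately have "summable (\<lambda>k. f (\<bar>real (v k) - real (v' k)\<bar> / 2 ^ c k)) \<longleftrightarrow>
        summable (\<lambda>n. f \<bar>e (X v) n - e (X v') n\<bar>)"
      using summable_mono_reindex[OF c(1), of "\<lambda>n. f \<bar>e (X v) n - e (X v') n\<bar>"] by simp
    then show ?thesis unfolding related_iff G_def .
  qed
  define K where "K = 2 powr q"
  have K: "0 < K" by (simp add: K_def)
  define W where "W k v v' = (\<Sum>j\<in>{l k..<l (Suc k)}. G v v' j)" for k v v'
  have W_nonneg: "0 \<le> W k v v'" for k v v' unfolding W_def using G_nonneg by (simp add: sum_nonneg)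
  have W_sym: "W k v v' = W k v' v" for k v v' by (simp add: W_def G_def abs_minus_commute)
  have W_triangle: "W k v v'' \<le> K * (W k v v' + W k v' v'')" for k v v' v''
    unfolding W_def sum.distrib[symmetric] sum_distrib_left G_def K_def
    by (intro sum_mono weak_triangle \<Theta>_unit)
  define \<delta> where "\<delta> k u i = (if i = k then u else 0)" for k u i :: nat
  define D where "D k u u' = W k (\<delta> k u) (\<delta> k u')" for k u u'
  have D_nonneg: "0 \<le> D k u u'" for k u u' unfolding D_def by (rule W_nonneg)
  \<comment> \<open>On the \<open>k\<close>-th window only the \<open>k\<close>-th coordinate matters; zero out the later ones first, then
    the earlier ones.\<close>
  have window: "W k v (\<delta> k (v k)) \<le> K * (2 * (1/2) ^ k)" if v: "good v" for v k
  proof -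
    define v' where "v' i = (if i \<le> k then v i else 0)" for i
    have good: "good v'" "good (\<delta> k (v k))" using v by (auto simp: good_def v'_def \<delta>_def)
    have "W k v v' \<le> (\<Sum>j<l (Suc k). G v v' j)"
      unfolding W_def using G_nonneg by (intro sum_mono2) auto
    also have "\<dots> \<le> (1/2) ^ Suc k"
      unfolding G_def using v good by (intro head X_cube) (auto simp: v'_def)
    also have "\<dots> \<le> (1/2) ^ k" by simp
    finally have 1: "W k v v' \<le> (1/2) ^ k" .
    have "W k v' (\<delta> k (v k)) \<le> (1/2) ^ k"
      unfolding W_def G_def using good by (intro tail X_cube) (auto simp: v'_def \<delta>_def)
    then have "K * (W k v v' + W k v' (\<delta> k (v k))) \<le> K * (2 * (1/2) ^ k)"
      using 1 K by (intro mult_left_mono) auto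
    then show ?thesis using W_triangle order_trans by blast
  qed
  define E where "E k = K * (K * (2 * (1/2) ^ k)) + K * (K * (K * (2 * (1/2) ^ k)))" for k :: nat
  have E: "summable E" unfolding E_def by (intro summable_add summable_mult) (simp_all add: summable_geometric)
  have four: "W k a d \<le> K * K * W k b c' + E k"
    if "W k a b \<le> K * (2 * (1/2) ^ k)" "W k c' d \<le> K * (2 * (1/2) ^ k)" for k a b c' d
  proof -
    have "W k b d \<le> K * (W k b c' + K * (2 * (1/2) ^ k))"
      using W_triangle[of k b d c'] that(2) K by (smt (verit) mult_left_mono)
    then have "K * (W k a b + W k b d) \<le> K * (K * (2 * (1/2) ^ k) + K * (W k b c' + K * (2 * (1/2) ^ k)))"
      using that(1) K by (intro mult_left_mono) auto
    then show ?thesis using W_triangle[of k a d b] by (simp add: E_def algebra_simps)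
  qed
  have D_iff: "summable (\<lambda>k. f (\<bar>real (v k) - real (v' k)\<bar> / 2 ^ c k)) \<longleftrightarrow>
      summable (\<lambda>k. D k (v k) (v' k))" if v: "good v" "good v'" for v v'
  proof -
    have DW: "D k (v k) (v' k) \<le> K * K * W k v v' + E k" for k
      unfolding D_def using window[OF v(1), of k] window[OF v(2), of k] by (intro four) (simp_all add: W_sym)
    have WD: "W k v v' \<le> K * K * D k (v k) (v' k) + E k" for k
      unfolding D_def using window[OF v(1), of k] window[OF v(2), of k] by (intro four) (simp_all add: W_sym)
    have "summable (\<lambda>k. D k (v k) (v' k)) \<longleftrightarrow> summable (\<lambda>k. W k v v')"
    proof
      assume "summable (\<lambda>k. D k (v k) (v' k))"
      then have "summable (\<lambda>k. K * K * D k (v k) (v' k) + E k)" by (intro summable_add summable_mult E)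
      then show "summable (\<lambda>k. W k v v')"
        by (rule summable_comparison_test') (use WD W_nonneg in simp)
    next
      assume "summable (\<lambda>k. W k v v')"
      then have "summable (\<lambda>k. K * K * W k v v' + E k)" by (intro summable_add summable_mult E)
      then show "summable (\<lambda>k. D k (v k) (v' k))"
        by (rule summable_comparison_test') (use DW D_nonneg in simp)
    qed
    then show ?thesis
      unfolding W_def G_iff[OF v] using summable_blocks_iff[OF l G_nonneg] by simp
  qed
  define r where "r k = (2::nat) ^ (c k - s k)" for k
  have r: "2 ^ s k * r k = 2 ^ c k" for k using c(2)[of k] by (simp add: r_def power_add[symmetric])
  have r_le: "i * r k \<le> 2 ^ c k" if "i \<le> 2 ^ s k" for i k
    using mult_right_mono[OF that, of "r k"] r[of k] by simp
  have "\<exists>i<2 ^ s k. g (1 / 2 ^ s k) * D k 0 (2 ^ c k) \<le> D k (i * r k) (Suc i * r k)" for k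
  proof (rule ccontr)
    let ?m = "(2::nat) ^ s k"
    assume "\<not> ?thesis"
    then have less: "D k (i * r k) (Suc i * r k) < g (1 / ?m) * D k 0 (2 ^ c k)" if "i < ?m" for i
      using that by force
    have "g (1 / ?m) * D k 0 (2 ^ c k) = (\<Sum>j\<in>{l k..<l (Suc k)}. g (1 / ?m) *
        g \<bar>\<Theta> (X (\<delta> k (0 * r k))) j - \<Theta> (X (\<delta> k (?m * r k))) j\<bar>)"
      by (simp add: D_def W_def G_def sum_distrib_left r)
    also have "\<dots> \<le> (\<Sum>j\<in>{l k..<l (Suc k)}. (\<Sum>i<?m.
        g \<bar>\<Theta> (X (\<delta> k (i * r k))) j - \<Theta> (X (\<delta> k (Suc i * r k))) j\<bar>) / ?m)"
      by (intro sum_mono path_estimate \<Theta>_unit) simp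
    also have "\<dots> = (\<Sum>i<?m. D k (i * r k) (Suc i * r k)) / ?m"
      unfolding D_def W_def G_def sum_divide_distrib[symmetric] by (subst sum.swap) (rule refl)
    also have "\<dots> < (\<Sum>i<?m. g (1 / ?m) * D k 0 (2 ^ c k)) / ?m"
      by (intro divide_strict_right_mono sum_strict_mono less) (auto simp: lessThan_empty_iff)
    also have "\<dots> = g (1 / ?m) * D k 0 (2 ^ c k)" by simp
    finally show False by simp
  qed
  then obtain i where i: "\<And>k. i k < 2 ^ s k"
    "\<And>k. g (1 / 2 ^ s k) * D k 0 (2 ^ c k) \<le> D k (i k * r k) (Suc (i k) * r k)"
    by metis
  have "summable (\<lambda>k. D k (i k * r k) (Suc (i k) * r k))"
  proof -
    have "\<bar>real (i k * r k) - real (Suc (i k) * r k)\<bar> / 2 ^ c k = 1 / 2 ^ s k" for k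
    proof -
      have "(2::real) ^ c k = 2 ^ s k * real (r k)" using r[of k, THEN arg_cong, of real] by simp
      moreover have "r k > 0" by (simp add: r_def)
      ultimately show ?thesis by (simp add: field_simps)
    qed
    moreover have "good (\<lambda>k. i k * r k)" "good (\<lambda>k. Suc (i k) * r k)"
      using i(1) r_le unfolding good_def by (simp_all add: Suc_leI less_imp_le del: mult_Suc)
    ultimately show ?thesis using D_iff[of "\<lambda>k. i k * r k" "\<lambda>k. Suc (i k) * r k"] summ_f by simp
  qed
  then have summ_gD: "summable (\<lambda>k. g (1 / 2 ^ s k) * D k 0 (2 ^ c k))"
    by (rule summable_comparison_test') (use i(2) D_nonneg nonneg in auto)
  have small: "\<exists>k>n. D k 0 (2 ^ c k) < \<eta>" if "0 < \<eta>" for n \<eta>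
  proof (rule ccontr)
    assume "\<not> ?thesis"
    then have "\<eta> \<le> D k 0 (2 ^ c k)" if "n < k" for k using that by force
    then have "norm (g (1 / 2 ^ s k) * \<eta>) \<le> g (1 / 2 ^ s k) * D k 0 (2 ^ c k)" if "Suc n \<le> k" for k
      using that \<open>0 < \<eta>\<close> nonneg[of "1 / 2 ^ s k"] by (auto simp: abs_mult intro!: mult_left_mono)
    then have "summable (\<lambda>k. g (1 / 2 ^ s k) * \<eta>)"
      by (rule summable_comparison_test'[OF summ_gD])
    then show False using not_summ_g \<open>0 < \<eta>\<close> by (simp add: mult.commute[of _ \<eta>] summable_cmult_iff)
  qed
  have "\<exists>\<phi>. \<forall>n. D (\<phi> n) 0 (2 ^ c (\<phi> n)) < (1/2) ^ n \<and> \<phi> n < \<phi> (Suc n)"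
  proof (rule dependent_nat_choice)
    show "\<exists>k. D k 0 (2 ^ c k) < (1/2) ^ 0" using small[of 1 0] by auto
    show "\<exists>k'. D k' 0 (2 ^ c k') < (1/2) ^ Suc n \<and> k < k'" for k n
      using small[of "(1/2) ^ Suc n" k] by auto
  qed
  then obtain \<phi> where \<phi>: "\<And>n. D (\<phi> n) 0 (2 ^ c (\<phi> n)) < (1/2) ^ n" "strict_mono \<phi>"
    unfolding strict_mono_Suc_iff by blast
  define v where "v k = (if k \<in> range \<phi> then 2 ^ c k else 0 :: nat)" for k
  have D_zero: "D k 0 0 = 0" for k by (simp add: D_def W_def G_def zero)
  have "summable (\<lambda>n. D (\<phi> n) 0 (v (\<phi> n)))"
    by (rule summable_comparison_test'[OF summable_geometric[of "1/2 :: real"]])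
       (use \<phi>(1) D_nonneg in \<open>auto simp: v_def less_imp_le\<close>)
  then have "summable (\<lambda>k. D k 0 (v k))"
    by (subst (asm) summable_mono_reindex[OF \<phi>(2), of "\<lambda>k. D k 0 (v k)"]) (auto simp: v_def D_zero)
  then have "summable (\<lambda>k. f (\<bar>real 0 - real (v k)\<bar> / 2 ^ c k))"
    by (subst D_iff[of "\<lambda>_. 0" v]) (auto simp: good_def v_def)
  then have "summable (\<lambda>n. f (\<bar>real 0 - real (v (\<phi> n))\<bar> / 2 ^ c (\<phi> n)))"
    by (subst summable_mono_reindex[OF \<phi>(2), of "\<lambda>k. f (\<bar>real 0 - real (v k)\<bar> / 2 ^ c k)"])
       (auto simp: v_def f)
  then have "summable (\<lambda>n::nat. f 1)" by (simp add: v_def)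
  then show False using f(2) by (simp add: summable_const_iff)
qed

section \<open>Suprema of scaled powers\<close>

lemma powr_convex_unit:
  fixes x y p t :: real
  assumes "1 \<le> p" "0 < t" "t < 1" "0 \<le> x" "0 \<le> y"
  shows "((1 - t) * x + t * y) powr p \<le> (1 - t) * x powr p + t * y powr p"
proof -
  have shrink: "(s * z) powr p \<le> s * z powr p" if "0 < s" "s < 1" "0 \<le> z" for s z :: real
  proof -
    have "s powr p \<le> s powr 1" using that assms(1) by (intro powr_mono') auto
    then show ?thesis using that by (simp add: powr_mult mult_right_mono)
  qed
  consider "x = 0" | "y = 0" | "0 < x" "0 < y" using assms by fastforce
  then show ?thesis
  proof cases
    case 1
    then show ?thesis using shrink[of t y] assms by simp
  next
    case 2
    then show ?thesis using shrink[of "1 - t" x] assms by simp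
  next
    case 3
    then show ?thesis using convex_onD[OF powr_convex[OF assms(1)], of t x y] assms by simp
  qed
qed

text \<open>
  As \<open>n\<close> grows, the exponents decrease to 1 while the coefficients drop doubly exponentially, so
  each index has its own range of \<open>t\<close> in which its term is the largest.
\<close>
definition scaled_power :: "real \<Rightarrow> nat \<Rightarrow> real \<Rightarrow> real" where
  "scaled_power \<delta> n t = (1/2) ^ 4 ^ n * t powr (1 + \<delta> / 2 ^ n)"

definition power_sup :: "real \<Rightarrow> nat set \<Rightarrow> real \<Rightarrow> real" where
  "power_sup \<delta> A t = (SUP n\<in>A. scaled_power \<delta> n t)"

context
  fixes \<delta> :: real and A :: "nat set"
  assumes \<delta>: "0 \<le> \<delta>" "\<delta> \<le> 1" and A: "A \<noteq> {}"
begin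

lemma exponent_bounds: "1 \<le> 1 + \<delta> / 2 ^ n" "1 + \<delta> / 2 ^ n \<le> 1 + \<delta>"
proof -
  have "\<delta> / 2 ^ n \<le> \<delta> / 1" using \<delta> by (intro divide_left_mono) auto
  then show "1 + \<delta> / 2 ^ n \<le> 1 + \<delta>" by simp
qed (use \<delta> in simp)

lemma scaled_power_nonneg: "0 \<le> scaled_power \<delta> n t"
  by (simp add: scaled_power_def)

lemma scaled_power_le_self:
  assumes "t \<in> {0..1}"
  shows "scaled_power \<delta> n t \<le> t"
proof -
  have "t powr (1 + \<delta> / 2 ^ n) \<le> t powr 1" using exponent_bounds assms by (intro powr_mono') auto
  moreover have "(1/2::real) ^ 4 ^ n \<le> 1" by (intro power_le_one) auto
  ultimately have "scaled_power \<delta> n t \<le> 1 * t"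
    unfolding scaled_power_def using assms by (intro mult_mono) auto
  then show ?thesis by simp
qed

lemma power_sup_upper: "n \<in> A \<Longrightarrow> t \<in> {0..1} \<Longrightarrow> scaled_power \<delta> n t \<le> power_sup \<delta> A t"
  unfolding power_sup_def using scaled_power_le_self by (intro cSUP_upper bdd_aboveI2) auto

lemma power_sup_least: "(\<And>n. n \<in> A \<Longrightarrow> scaled_power \<delta> n t \<le> u) \<Longrightarrow> power_sup \<delta> A t \<le> u"
  unfolding power_sup_def using A by (intro cSUP_least)

lemma power_sup_nonneg: "t \<in> {0..1} \<Longrightarrow> 0 \<le> power_sup \<delta> A t"
  using A power_sup_upper scaled_power_nonneg order_trans by (metis ex_in_conv)

lemma mult_power_sup_le:
  assumes "0 \<le> c" "0 \<le> u" "\<And>n. n \<in> A \<Longrightarrow> c * scaled_power \<delta> n t \<le> u"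
  shows "c * power_sup \<delta> A t \<le> u"
proof (cases "c = 0")
  case False
  then have "power_sup \<delta> A t \<le> u / c"
    using assms by (intro power_sup_least) (simp add: pos_le_divide_eq mult.commute)
  then show ?thesis using False assms by (simp add: pos_le_divide_eq mult.commute)
qed (use assms in simp)

lemma power_sup_le_self: "t \<in> {0..1} \<Longrightarrow> power_sup \<delta> A t \<le> t"
  by (intro power_sup_least scaled_power_le_self)

lemma power_sup_mono:
  assumes "0 \<le> s" "s \<le> t" "t \<le> 1"
  shows "power_sup \<delta> A s \<le> power_sup \<delta> A t"
proof (rule power_sup_least)
  fix n assume "n \<in> A"
  have "scaled_power \<delta> n s \<le> scaled_power \<delta> n t"
    unfolding scaled_power_def using assms exponent_bounds[of n]
    by (intro mult_left_mono powr_mono2) auto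
  also have "\<dots> \<le> power_sup \<delta> A t" using \<open>n \<in> A\<close> assms by (intro power_sup_upper) auto
  finally show "scaled_power \<delta> n s \<le> power_sup \<delta> A t" .
qed

lemma power_sup_scaling:
  assumes "s \<in> {0..1}" "r \<in> {0..1}"
  shows "s powr (1 + \<delta>) * power_sup \<delta> A r \<le> power_sup \<delta> A (s * r)"
proof (rule mult_power_sup_le)
  have sr: "s * r \<in> {0..1}" using assms by (auto simp: mult_le_one)
  then show "0 \<le> power_sup \<delta> A (s * r)" by (rule power_sup_nonneg)
  fix n assume n: "n \<in> A"
  have "s powr (1 + \<delta>) \<le> s powr (1 + \<delta> / 2 ^ n)"
    using assms exponent_bounds[of n] by (intro powr_mono') auto
  then have "s powr (1 + \<delta>) * scaled_power \<delta> n r \<le> s powr (1 + \<delta> / 2 ^ n) * scaled_power \<delta> n r"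
    by (intro mult_right_mono scaled_power_nonneg)
  also have "\<dots> = scaled_power \<delta> n (s * r)"
    using assms by (simp add: scaled_power_def powr_mult)
  also have "\<dots> \<le> power_sup \<delta> A (s * r)" using n sr by (rule power_sup_upper)
  finally show "s powr (1 + \<delta>) * scaled_power \<delta> n r \<le> power_sup \<delta> A (s * r)" .
qed simp

text \<open>
  For a product of two terms, replace the larger exponent by the smaller one, which is admissible
  because the base is at most 1, and drop one of the coefficients.
\<close>
lemma power_sup_supermult:
  assumes "s \<in> {0..1}" "r \<in> {0..1}"
  shows "power_sup \<delta> A s * power_sup \<delta> A r \<le> power_sup \<delta> A (s * r)"
proof -
  have sr: "s * r \<in> {0..1}" using assms by (auto simp: mult_le_one)
  have le: "scaled_power \<delta> n x * scaled_power \<delta> m y \<le> scaled_power \<delta> n (x * y)"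
    if "m \<le> n" "x \<in> {0..1}" "y \<in> {0..1}" for n m x y
  proof -
    have "\<delta> / 2 ^ n \<le> \<delta> / 2 ^ m" using that \<delta> by (intro divide_left_mono power_increasing) auto
    then have "y powr (1 + \<delta> / 2 ^ m) \<le> y powr (1 + \<delta> / 2 ^ n)" using that by (intro powr_mono') auto
    moreover have "(1/2::real) ^ 4 ^ m \<le> 1" by (intro power_le_one) auto
    ultimately have "scaled_power \<delta> m y \<le> 1 * y powr (1 + \<delta> / 2 ^ n)"
      unfolding scaled_power_def by (intro mult_mono) auto
    then have "scaled_power \<delta> n x * scaled_power \<delta> m y \<le> scaled_power \<delta> n x * y powr (1 + \<delta> / 2 ^ n)"
      by (intro mult_left_mono scaled_power_nonneg) simp
    also have "\<dots> = scaled_power \<delta> n (x * y)" using that by (simp add: scaled_power_def powr_mult)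
    finally show ?thesis .
  qed
  have terms: "scaled_power \<delta> n s * scaled_power \<delta> m r \<le> power_sup \<delta> A (s * r)" if "n \<in> A" "m \<in> A" for n m
  proof (cases "m \<le> n")
    case True
    show ?thesis by (rule order_trans[OF le[OF True assms] power_sup_upper[OF that(1) sr]])
  next
    case False
    then have "scaled_power \<delta> m r * scaled_power \<delta> n s \<le> scaled_power \<delta> m (r * s)"
      using assms by (intro le) auto
    also have "\<dots> \<le> power_sup \<delta> A (s * r)" using power_sup_upper[OF that(2) sr] by (simp add: mult.commute)
    finally show ?thesis by (simp add: mult.commute)
  qed
  have "scaled_power \<delta> n s * power_sup \<delta> A r \<le> power_sup \<delta> A (s * r)" if "n \<in> A" for n
    using that sr terms by (intro mult_power_sup_le scaled_power_nonneg power_sup_nonneg)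
  then have "power_sup \<delta> A r * power_sup \<delta> A s \<le> power_sup \<delta> A (s * r)"
    using sr assms by (intro mult_power_sup_le power_sup_nonneg) (simp_all add: mult.commute)
  then show ?thesis by (simp add: mult.commute)
qed

lemma power_sup_convex: "convex_on {0..1} (power_sup \<delta> A)"
proof (rule convex_onI)
  fix t x y :: real
  assume t: "0 < t" "t < 1" and xy: "x \<in> {0..1}" "y \<in> {0..1}"
  show "power_sup \<delta> A ((1 - t) *\<^sub>R x + t *\<^sub>R y) \<le> (1 - t) * power_sup \<delta> A x + t * power_sup \<delta> A y"
  proof (rule power_sup_least)
    fix n assume n: "n \<in> A"
    have "scaled_power \<delta> n ((1 - t) *\<^sub>R x + t *\<^sub>R y) \<le>
        (1/2) ^ 4 ^ n * ((1 - t) * x powr (1 + \<delta> / 2 ^ n) + t * y powr (1 + \<delta> / 2 ^ n))"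
      unfolding scaled_power_def using t xy exponent_bounds[of n]
      by (simp add: powr_convex_unit)
    also have "\<dots> = (1 - t) * scaled_power \<delta> n x + t * scaled_power \<delta> n y"
      by (simp add: scaled_power_def algebra_simps)
    also have "\<dots> \<le> (1 - t) * power_sup \<delta> A x + t * power_sup \<delta> A y"
      using t xy n by (intro add_mono mult_left_mono power_sup_upper) auto
    finally show "scaled_power \<delta> n ((1 - t) *\<^sub>R x + t *\<^sub>R y) \<le> (1 - t) * power_sup \<delta> A x + t * power_sup \<delta> A y" .
  qed
qed simp

text \<open>
  For \<open>x = s * y\<close> with \<open>s \<le> 1\<close>, scaling bounds the increment from \<open>x\<close> to \<open>y\<close> by \<open>(1 - s powr (1 + \<delta>)) * y\<close>,
  which is at most \<open>(1 - s\<^sup>2) * y \<le> 2 * (y - x)\<close>; so the function is Lipschitz.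
\<close>
lemma power_sup_continuous: "continuous_on {0..1} (power_sup \<delta> A)"
proof -
  have diff: "\<bar>power_sup \<delta> A y - power_sup \<delta> A x\<bar> \<le> 2 * (y - x)" if "0 \<le> x" "x \<le> y" "y \<le> 1" for x y
  proof (cases "y = 0")
    case False
    define s where "s = x / y"
    have s: "0 \<le> s" "s \<le> 1" "s * y = x" using that False by (auto simp: s_def)
    have "s ^ 2 \<le> s powr (1 + \<delta>)"
    proof (cases "s = 0")
      case False
      then have "s ^ 2 = s powr 2" using s by (simp add: powr_numeral)
      also have "\<dots> \<le> s powr (1 + \<delta>)" using s \<delta> by (intro powr_mono') auto
      finally show ?thesis .
    qed simp
    have "(1 - s)\<^sup>2 \<ge> 0" by simp
    then have "1 - s powr (1 + \<delta>) \<le> 2 * (1 - s)"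
      using \<open>s ^ 2 \<le> s powr (1 + \<delta>)\<close> by (simp add: power2_eq_square algebra_simps)
    then have "(1 - s powr (1 + \<delta>)) * power_sup \<delta> A y \<le> 2 * (1 - s) * y"
      using s that by (intro mult_mono power_sup_le_self power_sup_nonneg) auto
    moreover have "s powr (1 + \<delta>) * power_sup \<delta> A y \<le> power_sup \<delta> A x"
      using power_sup_scaling[of s y] s that by simp
    ultimately have "power_sup \<delta> A y - power_sup \<delta> A x \<le> 2 * (y - x)"
      using s(3) by (simp add: algebra_simps)
    then show ?thesis using power_sup_mono[OF that] by simp
  qed (use that in auto)
  have "2-lipschitz_on {0..1} (power_sup \<delta> A)"
  proof (rule lipschitz_onI)
    fix x y :: real assume "x \<in> {0..1}" "y \<in> {0..1}"
    then show "dist (power_sup \<delta> A x) (power_sup \<delta> A y) \<le> 2 * dist x y"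
      using diff[of x y] diff[of y x] by (cases "x \<le> y") (auto simp: dist_real_def abs_minus_commute)
  qed simp
  then show ?thesis by (rule lipschitz_on_continuous_on)
qed

lemma gauge_power_sup: "gauge (power_sup \<delta> A) (1 + \<delta>)"
proof
  obtain n where n: "n \<in> A" using A by blast
  have "0 < scaled_power \<delta> n 1" by (simp add: scaled_power_def)
  also have "\<dots> \<le> power_sup \<delta> A 1" using n by (intro power_sup_upper) auto
  finally show "0 < power_sup \<delta> A 1" .
  show "power_sup \<delta> A 1 \<le> 1" by (rule power_sup_le_self) simp
  show "power_sup \<delta> A 0 = 0"
    using power_sup_le_self[of 0] power_sup_nonneg[of 0] by simp
qed (use \<delta> power_sup_continuous power_sup_convex power_sup_scaling power_sup_supermult in auto)

end

text \<open>
  With \<open>\<delta> = 1 / L\<close> the \<open>k\<close>-th term at the point \<open>1 / 2 ^ (2 * L * 8 ^ n)\<close> is 2 to the power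
  \<open>- (4 ^ k + 2 * 8 ^ n / 2 ^ k)\<close>, up to a factor independent of \<open>k\<close>. The sum \<open>4 ^ k + 2 * 8 ^ n / 2 ^ k\<close> is
  \<open>3 * 4 ^ n\<close> for \<open>k = n\<close> and at least \<open>4 * 4 ^ n\<close> otherwise: for \<open>k < n\<close> because of the second summand,
  for \<open>k > n\<close> because of the first.
\<close>
lemma scaled_power_gap:
  fixes L :: nat
  assumes "0 < L" "k \<noteq> n"
  shows "scaled_power (1 / L) k (1 / 2 ^ (2 * L * 8 ^ n)) \<le> (1/2) ^ n * scaled_power (1 / L) n (1 / 2 ^ (2 * L * 8 ^ n))"
proof -
  have eq: "scaled_power (1 / L) k (1 / 2 ^ (2 * L * 8 ^ n)) =
      2 powr - (4 ^ k + 2 * L * 8 ^ n + 2 * 8 ^ n / 2 ^ k)" for k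
  proof -
    have "(1 / 2 ^ (2 * L * 8 ^ n) :: real) = 2 powr - (2 * real L * 8 ^ n)"
      by (simp add: powr_minus_divide powr_realpow[symmetric])
    then have "(1 / 2 ^ (2 * L * 8 ^ n)) powr (1 + 1 / L / 2 ^ k) =
        (2::real) powr (- (2 * real L * 8 ^ n) * (1 + 1 / L / 2 ^ k))"
      by (simp add: powr_powr)
    also have "- (2 * real L * 8 ^ n) * (1 + 1 / L / 2 ^ k) = - (2 * L * 8 ^ n + 2 * 8 ^ n / 2 ^ k)"
      using assms(1) by (simp add: field_simps)
    finally have "(1 / 2 ^ (2 * L * 8 ^ n)) powr (1 + 1 / L / 2 ^ k) =
        (2::real) powr - (2 * L * 8 ^ n + 2 * 8 ^ n / 2 ^ k)" .
    moreover have "(1/2::real) ^ 4 ^ k = 2 powr - (4 ^ k)"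
      by (simp add: powr_minus_divide powr_realpow[symmetric] power_divide)
    ultimately show ?thesis unfolding scaled_power_def by (simp add: powr_add[symmetric] algebra_simps)
  qed
  have eight: "(8::real) ^ n = 4 ^ n * 2 ^ n" by (simp add: power_mult_distrib[symmetric])
  have gap: "4 * 4 ^ n \<le> (4::real) ^ k + 2 * 8 ^ n / 2 ^ k"
  proof (cases "k < n")
    case True
    then have "2 * 2 ^ k \<le> (2::real) ^ n" using power_increasing[of "Suc k" n "2::real"] by simp
    then have "4 ^ n * (2 * 2 ^ k) \<le> (4::real) ^ n * 2 ^ n" by (intro mult_left_mono) auto
    then have "4 * 4 ^ n \<le> 2 * 8 ^ n / (2::real) ^ k" by (simp add: eight field_simps)
    moreover have "0 \<le> (4::real) ^ k" by simp
    ultimately show ?thesis by linarith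
  next
    case False
    then have "4 * 4 ^ n \<le> (4::real) ^ k" using assms(2) power_increasing[of "Suc n" k "4::real"] by simp
    moreover have "0 \<le> 2 * 8 ^ n / (2::real) ^ k" by simp
    ultimately show ?thesis by linarith
  qed
  have n4: "real n \<le> 4 ^ n" using of_nat_mono[of n "4 ^ n"] less_imp_le[OF power_gt_expt[of 4 n]] by simp
  have "2 * 8 ^ n / (2::real) ^ n = 2 * 4 ^ n" by (simp add: eight)
  then have "- (4 ^ k + 2 * L * 8 ^ n + 2 * 8 ^ n / 2 ^ k) \<le> - real n + - (4 ^ n + 2 * L * 8 ^ n + 2 * 8 ^ n / 2 ^ n)"
    unfolding of_nat_add of_nat_power of_nat_numeral using gap n4 by linarith
  then have "scaled_power (1 / L) k (1 / 2 ^ (2 * L * 8 ^ n)) \<le>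
      2 powr (- real n + - (4 ^ n + 2 * L * 8 ^ n + 2 * 8 ^ n / 2 ^ n))"
    unfolding eq by (intro powr_mono) auto
  also have "\<dots> = (1/2) ^ n * scaled_power (1 / L) n (1 / 2 ^ (2 * L * 8 ^ n))"
    unfolding eq powr_add by (simp add: powr_minus_divide powr_realpow power_divide)
  finally show ?thesis .
qed

section \<open>An almost disjoint family of suprema\<close>

text \<open>
  List each \<open>n\<close> exactly \<open>\<lceil>1 / b n\<rceil>\<close> times: it then contributes at least 1 to the sum of \<open>b\<close>, but at most
  \<open>2 * (1/2) ^ n\<close> to that of \<open>a\<close>.
\<close>
lemma repetition_separates_sums:
  fixes a b :: "nat \<Rightarrow> real"
  assumes I: "infinite I"
    and a: "\<And>n. n \<in> I \<Longrightarrow> 0 \<le> a n" "\<And>n. n \<in> I \<Longrightarrow> a n \<le> (1/2) ^ n * b n"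
    and b: "\<And>n. n \<in> I \<Longrightarrow> 0 < b n" "\<And>n. n \<in> I \<Longrightarrow> b n \<le> 1"
  shows "\<exists>\<nu>. summable (\<lambda>k. a (\<nu> k)) \<and> \<not> summable (\<lambda>k. b (\<nu> k))"
proof -
  define R where "R n = nat \<lceil>1 / b n\<rceil>" for n
  have R: "1 / b n \<le> R n" "R n \<le> 1 / b n + 1" if "n \<in> I" for n
  proof -
    have "0 < 1 / b n" using b(1)[OF that] by simp
    then show "1 / b n \<le> R n" "R n \<le> 1 / b n + 1" unfolding R_def by linarith+
  qed
  have Rb: "1 \<le> R n * b n" if "n \<in> I" for n
    using R(1)[OF that] b(1)[OF that] by (simp add: pos_divide_le_eq)
  have Ra: "R n * a n \<le> 2 * (1/2) ^ n" if "n \<in> I" for n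
  proof -
    have "R n * a n \<le> (1 / b n + 1) * ((1/2) ^ n * b n)"
      using R(2) a b(1) that by (intro mult_mono) (auto simp: less_imp_le)
    also have "\<dots> = (1 + b n) * (1/2) ^ n" using b(1)[OF that] by (simp add: field_simps)
    also have "\<dots> \<le> 2 * (1/2) ^ n" using b(2)[OF that] by (intro mult_right_mono) auto
    finally show ?thesis .
  qed
  define S where "S = Sigma I (\<lambda>n. {..<R n})"
  have "fst ` S = I"
  proof -
    have "0 < R n" if "n \<in> I" for n using Rb[OF that] by (cases "R n") auto
    then show ?thesis by (force simp: S_def)
  qed
  then have "infinite S" using I finite_imageI by metis
  then have bij: "bij_betw (from_nat_into S) UNIV S" by (intro bij_betw_from_nat_into) auto
  define \<nu> where "\<nu> k = fst (from_nat_into S k)" for k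
  have \<nu>: "\<nu> k \<in> I" for k
  proof -
    have "from_nat_into S k \<in> S" using bij_betwE[OF bij] by blast
    then show ?thesis unfolding \<nu>_def S_def by (elim SigmaE) simp
  qed
  have reindex: "summable (\<lambda>k. h (\<nu> k)) \<longleftrightarrow> (\<lambda>p. h (fst p)) summable_on S"
    if "\<And>n. n \<in> I \<Longrightarrow> 0 \<le> h n" for h :: "nat \<Rightarrow> real"
    unfolding summable_on_reindex_bij_betw[OF bij, symmetric] \<nu>_def[symmetric]
    by (intro summable_on_UNIV_nonneg_real_iff[symmetric] that \<nu>)
  have "(\<lambda>p. a (fst p)) summable_on S"
    unfolding S_def
  proof (rule summable_on_SigmaI)
    show "((\<lambda>y. a (fst (n, y))) has_sum (R n * a n)) {..<R n}" for n
      using has_sum_finite[of "{..<R n}" "\<lambda>_. a n"] by simp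
    have "(\<lambda>n. 2 * (1/2::real) ^ n) summable_on UNIV"
      by (subst summable_on_UNIV_nonneg_real_iff) (auto intro!: summable_mult summable_geometric)
    then have "(\<lambda>n. 2 * (1/2::real) ^ n) summable_on I"
      by (rule summable_on_subset_banach) simp
    then show "(\<lambda>n. R n * a n) summable_on I"
      by (rule summable_on_comparison_test) (use Ra a(1) in auto)
  qed (use a(1) in auto)
  moreover have "\<not> (\<lambda>p. b (fst p)) summable_on S"
  proof
    assume summ: "(\<lambda>p. b (fst p)) summable_on S"
    define C where "C = infsum (\<lambda>p. b (fst p)) S"
    obtain J where J: "J \<subseteq> I" "finite J" "card J = nat \<lceil>C\<rceil> + 1"
      using infinite_arbitrarily_large[OF I] by blast
    have "C < real (card J)" using J(3) by linarith
    also have "\<dots> = (\<Sum>n\<in>J. 1)" by simp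
    also have "\<dots> \<le> (\<Sum>n\<in>J. R n * b n)" using Rb J by (intro sum_mono) auto
    also have "\<dots> = (\<Sum>n\<in>J. \<Sum>i<R n. b n)" by simp
    also have "\<dots> = (\<Sum>p\<in>Sigma J (\<lambda>n. {..<R n}). b (fst p))"
      using J by (subst sum.Sigma) (auto simp: case_prod_unfold)
    also have "\<dots> \<le> C"
      unfolding C_def using J b(1) summ
      by (intro finite_sum_le_infsum) (auto simp: S_def less_imp_le)
    finally show False by simp
  qed
  ultimately show ?thesis using reindex[of a] reindex[of b] a(1) b(1) less_imp_le by metis
qed

text \<open>
  The codes of the finite initial segments of \<open>\<xi>\<close>; branches of distinct sequences are almost
  disjoint.
\<close>
definition branch :: "(nat \<Rightarrow> bool) \<Rightarrow> nat set" where
  "branch \<xi> = range (\<lambda>n. to_nat (map \<xi> [0..<n]))"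

lemma inj_branch: "inj (\<lambda>n. to_nat (map \<xi> [0..<n]))"
proof (rule injI)
  fix m n assume "to_nat (map \<xi> [0..<m]) = to_nat (map \<xi> [0..<n])"
  then have "map \<xi> [0..<m] = map \<xi> [0..<n]" by simp
  then have "length (map \<xi> [0..<m]) = length (map \<xi> [0..<n])" by (rule arg_cong)
  then show "m = n" by simp
qed

lemma branch_nonempty: "branch \<xi> \<noteq> {}"
  by (simp add: branch_def)

lemma infinite_branch_diff:
  assumes "\<xi> \<noteq> \<zeta>"
  shows "infinite (branch \<xi> - branch \<zeta>)"
proof -
  obtain i where i: "\<xi> i \<noteq> \<zeta> i" using assms by blast
  have "to_nat (map \<xi> [0..<n]) \<notin> branch \<zeta>" if "i < n" for n
  proof
    assume "to_nat (map \<xi> [0..<n]) \<in> branch \<zeta>"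
    then obtain m where m: "map \<xi> [0..<n] = map \<zeta> [0..<m]" by (auto simp: branch_def)
    then have "m = n" by (metis length_map length_upt diff_zero)
    then have "map \<xi> [0..<n] ! i = map \<zeta> [0..<n] ! i" using arg_cong[OF m, of "\<lambda>xs. xs ! i"] by simp
    then show False using i that by simp
  qed
  then have "(\<lambda>n. to_nat (map \<xi> [0..<n])) ` {i<..} \<subseteq> branch \<xi> - branch \<zeta>"
    by (auto simp: branch_def)
  moreover have "infinite ((\<lambda>n. to_nat (map \<xi> [0..<n])) ` {i<..})"
    using finite_imageD[OF _ inj_on_subset[OF inj_branch]] infinite_Ioi by blast
  ultimately show ?thesis using finite_subset by blast
qed

lemma power_sup_separation:
  fixes L :: nat
  assumes L: "0 < L" and A: "A \<noteq> {}" and BA: "infinite (B - A)"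
  shows "\<exists>s. summable (\<lambda>k. power_sup (1 / L) A (1 / 2 ^ s k)) \<and>
           \<not> summable (\<lambda>k. power_sup (1 / L) B (1 / 2 ^ s k))"
proof -
  define u where "u n = (1 / 2 ^ (2 * L * 8 ^ n) :: real)" for n
  have u: "0 < u n" "u n \<in> {0..1}" for n by (auto simp: u_def divide_le_eq_1)
  have \<delta>: "0 \<le> 1 / real L" "1 / real L \<le> 1" using L by auto
  have B: "B \<noteq> {}" using BA by auto
  interpret g: gauge "power_sup (1 / L) B" "1 + 1 / L" using \<delta> B by (rule gauge_power_sup)
  have "\<exists>\<nu>. summable (\<lambda>k. power_sup (1 / L) A (u (\<nu> k))) \<and> \<not> summable (\<lambda>k. power_sup (1 / L) B (u (\<nu> k)))"
  proof (rule repetition_separates_sums[OF BA])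
    fix n assume n: "n \<in> B - A"
    show "0 \<le> power_sup (1 / L) A (u n)" using power_sup_nonneg[OF \<delta> A u(2)] .
    show "0 < power_sup (1 / L) B (u n)" using u[of n] by (intro g.pos) auto
    show "power_sup (1 / L) B (u n) \<le> 1" using power_sup_le_self[OF \<delta> B u(2)[of n]] u(2)[of n] by auto
    show "power_sup (1 / L) A (u n) \<le> (1/2) ^ n * power_sup (1 / L) B (u n)"
    proof (rule power_sup_least[OF \<delta> A])
      fix k assume "k \<in> A"
      then have "scaled_power (1 / L) k (u n) \<le> (1/2) ^ n * scaled_power (1 / L) n (u n)"
        unfolding u_def using L n by (intro scaled_power_gap) auto
      also have "\<dots> \<le> (1/2) ^ n * power_sup (1 / L) B (u n)"
        using n u(2) by (intro mult_left_mono power_sup_upper[OF \<delta> B]) auto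
      finally show "scaled_power (1 / L) k (u n) \<le> (1/2) ^ n * power_sup (1 / L) B (u n)" .
    qed
  qed
  then show ?thesis unfolding u_def by (elim exE) (rule exI)
qed

section \<open>The antichain\<close>

theorem theorem3p3:
  fixes \<beta> :: real
  assumes "\<beta> > 1"
  shows "\<exists>f :: (nat \<Rightarrow> bool) \<Rightarrow> real \<Rightarrow> real.
    (\<forall>\<xi>. continuous_on {0..1} (f \<xi>) \<and> f \<xi> \<in> {0..1} \<rightarrow> {0..} \<and>
         equiv unit_sequences (E_rel (f \<xi>)) \<and>
         borel_reducible UNIV (lp_rel 1) unit_sequences (E_rel (f \<xi>)) \<and>
         borel_reducible unit_sequences (E_rel (f \<xi>)) UNIV (lp_rel \<beta>)) \<and>
    (\<forall>\<xi> \<zeta>. \<xi> \<noteq> \<zeta> \<longrightarrow>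
         borel_incomparable unit_sequences (E_rel (f \<xi>)) unit_sequences (E_rel (f \<zeta>)))"
proof -
  obtain n where n: "inverse (real (Suc n)) < \<beta> - 1" using reals_Archimedean[of "\<beta> - 1"] assms by auto
  define L where "L = Suc n"
  have L: "0 < L" "1 + 1 / L < \<beta>" using n by (auto simp: L_def inverse_eq_divide)
  define f where "f \<xi> = power_sup (1 / L) (branch \<xi>)" for \<xi>
  have gauge: "gauge (f \<xi>) (1 + 1 / L)" for \<xi>
    unfolding f_def using L(1) branch_nonempty by (intro gauge_power_sup) auto
  have not_red: "\<not> borel_reducible unit_sequences (E_rel (f \<xi>)) unit_sequences (E_rel (f \<zeta>))"
    if "\<xi> \<noteq> \<zeta>" for \<xi> \<zeta>
  proof -
    have "infinite (branch \<zeta> - branch \<xi>)" using that by (intro infinite_branch_diff) simp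
    then obtain s where "summable (\<lambda>k. f \<xi> (1 / 2 ^ s k))" "\<not> summable (\<lambda>k. f \<zeta> (1 / 2 ^ s k))"
      using power_sup_separation[OF L(1) branch_nonempty] unfolding f_def by blast
    then show ?thesis
      by (rule gauge.not_reducible[OF gauge[of \<zeta>] gauge.zero[OF gauge[of \<xi>]]
            gauge.one_pos[OF gauge[of \<xi>]]])
  qed
  show ?thesis
  proof (intro exI[of _ f] conjI allI impI)
    fix \<xi> \<zeta> :: "nat \<Rightarrow> bool"
    show "continuous_on {0..1} (f \<xi>)" using gauge by (rule gauge.cont)
    show "f \<xi> \<in> {0..1} \<rightarrow> {0..}" using gauge.nonneg[OF gauge] by auto
    show "equiv unit_sequences (E_rel (f \<xi>))" using gauge by (rule gauge.equiv_E_rel)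
    show "borel_reducible UNIV (lp_rel 1) unit_sequences (E_rel (f \<xi>))"
      using gauge by (rule gauge.l1_reducible)
    show "borel_reducible unit_sequences (E_rel (f \<xi>)) UNIV (lp_rel \<beta>)"
      using gauge L(2) by (rule gauge.reducible_to_lp)
    assume "\<xi> \<noteq> \<zeta>"
    then show "borel_incomparable unit_sequences (E_rel (f \<xi>)) unit_sequences (E_rel (f \<zeta>))"
      unfolding borel_incomparable_def using not_red[of \<xi> \<zeta>] not_red[of \<zeta> \<xi>] by simp
  qed
qed

end
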